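(* (Type A rank-level duality.) Let $N,k\ge2$. The assignment $S_{(\mu)}\mapsto S'_{(\tilde\mu)}$, for partitions $(\mu)$ with at most $N$ parts and largest part at most $k$, where $(\tilde\mu)$ is the conjugate partition of $(\mu)$, defines an isomorphism of $\mathbb{Q}$-algebras $\Lambda_N/\bar I^{(N,k)}\to\Lambda_k/\bar I^{(k,N)}$. Equivalently, $\mathcal{F}'(A_{N-1},k)\cong\mathcal{F}'(A_{k-1},N)$.
   Context: For $n\ge1$, $\Lambda_n=\mathbb{Q}[x_1,\dots,x_n]^{S_n}$ is the algebra of symmetric polynomials in $n$ variables, $h_m$ the complete homogeneous symmetric polynomials ($h_0=1$, $h_m=0$ for $m<0$), and for a partition $(\mu)=(\mu_1,\dots,\mu_n)$ of length at most $n$, $S_{(\mu)}=\det(h_{\mu_i-i+j})_{i,j=1}^n$ is the Schur polynomial. For $n,l\ge1$, $I^{(n,l)}$ is the ideal of $\Lambda_n$ generated by $S_{(1^n)}-1$ and all $S_{(\mu)}$ with $(\mu)$ of length at most $n$ and $\mu_1-\mu_n=l+1$, and $\bar I^{(n,l)}$ is the ideal generated by $I^{(n,l)}$ together with $h_l-1$. Schur polynomials in $\Lambda_N$ are written $S_{(\mu)}$, those in $\Lambda_k$ are written $S'_{(\mu)}$ (and $h'_m$ for complete homogeneous polynomials in $\Lambda_k$), so $\bar I^{(k,N)}$ contains $S'_{(1^k)}-1$ and $h'_N-1$. The fusion algebra of type $A_{N-1}$ and level $k$ is $\mathcal{F}(A_{N-1},k)=\Lambda_N/I^{(N,k)}$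 (Goodman–Wenzl); its basis element $V^{k\lambda_1}$ corresponds to $h_k=S_{(k)}$ and $V^0$ to $1$. $\mathcal{F}'(A_{N-1},k)=\mathcal{F}(A_{N-1},k)/\langle V^{k\lambda_1}-V^0\rangle=\Lambda_N/\bar I^{(N,k)}$ and $\mathcal{F}'(A_{k-1},N)=\mathcal{F}(A_{k-1},N)/\langle V^{N\lambda_1}-V^0\rangle=\Lambda_k/\bar I^{(k,N)}$. *)

theory Defs
  imports
    "HOL-Library.Poly_Mapping"
    "HOL-Combinatorics.Permutations"
    "HOL-Algebra.Module"
    "HOL-Algebra.QuotRing"
    "Jordan_Normal_Form.Determinant"
begin

section \<open>Algebras over the rationals\<close>

text \<open>A rational algebra is a record of type \<open>(rat, 'a) module\<close>: a ring together with a scalar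
  multiplication by rational numbers.\<close>

definition linear_map_on ::
  "(rat, 'a, 'm) module_scheme \<Rightarrow> (rat, 'b, 'n) module_scheme \<Rightarrow> ('a \<Rightarrow> 'b) \<Rightarrow> bool" where
  "linear_map_on A B f \<longleftrightarrow>
     f \<in> carrier A \<rightarrow> carrier B \<and>
     (\<forall>x\<in>carrier A. \<forall>y\<in>carrier A. f (x \<oplus>\<^bsub>A\<^esub> y) = f x \<oplus>\<^bsub>B\<^esub> f y) \<and>
     (\<forall>c. \<forall>x\<in>carrier A. f (c \<odot>\<^bsub>A\<^esub> x) = c \<odot>\<^bsub>B\<^esub> f x)"

definition alg_iso ::
  "(rat, 'a, 'm) module_scheme \<Rightarrow> (rat, 'b, 'n) module_scheme \<Rightarrow> ('a \<Rightarrow> 'b) set" where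
  "alg_iso A B = {f \<in> ring_iso A B. linear_map_on A B f}"

text \<open>The ring \<open>A Quot J\<close> with the induced scalar multiplication. The scalar multiple of the
  coset \<open>X = J + x\<close> is \<open>J + c X = J + c x\<close>; adding \<open>J\<close> is needed only for \<open>c = 0\<close>.\<close>

definition quot_alg :: "(rat, 'a, 'm) module_scheme \<Rightarrow> 'a set \<Rightarrow> (rat, 'a set) module" where
  "quot_alg A J = ring.extend (A Quot J)
     (module.fields (\<lambda>c X. J <+>\<^bsub>A\<^esub> (\<lambda>x. c \<odot>\<^bsub>A\<^esub> x) ` X))"

section \<open>Symmetric polynomials\<close>

text \<open>Polynomials have variables indexed by the natural numbers (starting at \<open>0\<close>); a monomial
  is its exponent vector.\<close>

type_synonym qpoly = "(nat \<Rightarrow>\<^sub>0 nat) \<Rightarrow>\<^sub>0 rat"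

definition sym_polys :: "nat \<Rightarrow> qpoly set" where
  "sym_polys n = {p.
     (\<forall>a\<in>Poly_Mapping.keys p. Poly_Mapping.keys a \<subseteq> {..<n}) \<and>
     (\<forall>\<sigma>. \<sigma> permutes {..<n} \<longrightarrow>
        (\<forall>a. Poly_Mapping.lookup p (Poly_Mapping.map_key \<sigma> a) = Poly_Mapping.lookup p a))}"

definition Lam :: "nat \<Rightarrow> (rat, qpoly) module" where
  "Lam n = \<lparr>carrier = sym_polys n, monoid.mult = (*), one = 1, zero = 0, add = (+),
     module.smult = (\<lambda>c p. Poly_Mapping.single 0 c * p)\<rparr>"

text \<open>For \<open>m < 0\<close> the sum is empty.\<close>

definition hsym :: "nat \<Rightarrow> int \<Rightarrow> qpoly" where
  "hsym n m = (\<Sum>a | Poly_Mapping.keys a \<subseteq> {..<n} \<and>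
                  int (\<Sum>i<n. Poly_Mapping.lookup a i) = m. Poly_Mapping.single a 1)"

section \<open>Partitions and Schur polynomials\<close>

text \<open>Partitions of length at most \<open>n\<close>, as weakly decreasing sequences indexed from \<open>0\<close>: the
  part usually written \<open>\<mu>\<^sub>1\<close> is \<open>\<mu> 0\<close>, and \<open>\<mu>\<^sub>n\<close> is \<open>\<mu> (n - 1)\<close>.\<close>

definition partition_le :: "nat \<Rightarrow> (nat \<Rightarrow> nat) \<Rightarrow> bool" where
  "partition_le n \<mu> \<longleftrightarrow> antimono \<mu> \<and> (\<forall>i\<ge>n. \<mu> i = 0)"

definition conj_part :: "(nat \<Rightarrow> nat) \<Rightarrow> nat \<Rightarrow> nat" where
  "conj_part \<mu> j = card {i. j < \<mu> i}"

definition schur :: "nat \<Rightarrow> (nat \<Rightarrow> nat) \<Rightarrow> qpoly" where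
  "schur n \<mu> = det (mat n n (\<lambda>(i, j). hsym n (int (\<mu> i) - int i + int j)))"

definition col_part :: "nat \<Rightarrow> nat \<Rightarrow> nat" where
  "col_part n i = (if i < n then 1 else 0)"

section \<open>Fusion algebras of type A\<close>

definition fusion_ideal :: "nat \<Rightarrow> nat \<Rightarrow> qpoly set" where
  "fusion_ideal n l = Idl\<^bsub>Lam n\<^esub>
     ({schur n (col_part n) - 1} \<union>
      {schur n \<mu> | \<mu>. partition_le n \<mu> \<and> int (\<mu> 0) - int (\<mu> (n - 1)) = int l + 1})"

definition fusion_ideal_bar :: "nat \<Rightarrow> nat \<Rightarrow> qpoly set" where
  "fusion_ideal_bar n l = Idl\<^bsub>Lam n\<^esub> (fusion_ideal n l \<union> {hsym n (int l) - 1})"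

text \<open>\<open>fusion_alg n l\<close> is the fusion algebra of type \<open>A\<^bsub>n-1\<^esub>\<close> and level \<open>l\<close>; in it,
  \<open>fusion_top n l\<close> is the basis element \<open>V\<close> with highest weight \<open>l \<lambda>\<^sub>1\<close>, and the unit is the one
  with highest weight \<open>0\<close>.\<close>

definition fusion_alg :: "nat \<Rightarrow> nat \<Rightarrow> (rat, qpoly set) module" where
  "fusion_alg n l = quot_alg (Lam n) (fusion_ideal n l)"

definition fusion_top :: "nat \<Rightarrow> nat \<Rightarrow> qpoly set" where
  "fusion_top n l = fusion_ideal n l +>\<^bsub>Lam n\<^esub> hsym n (int l)"

definition fusion_alg' :: "nat \<Rightarrow> nat \<Rightarrow> (rat, qpoly set set) module" where
  "fusion_alg' n l = quot_alg (fusion_alg n l)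
     (Idl\<^bsub>fusion_alg n l\<^esub> {fusion_top n l \<ominus>\<^bsub>fusion_alg n l\<^esub> \<one>\<^bsub>fusion_alg n l\<^esub>})"

definition fusion_quot :: "nat \<Rightarrow> nat \<Rightarrow> (rat, qpoly set) module" where
  "fusion_quot n l = quot_alg (Lam n) (fusion_ideal_bar n l)"

definition schur_class :: "nat \<Rightarrow> nat \<Rightarrow> (nat \<Rightarrow> nat) \<Rightarrow> qpoly set" where
  "schur_class n l \<mu> = fusion_ideal_bar n l +>\<^bsub>Lam n\<^esub> schur n \<mu>"

text \<open>\<open>f\<close> sends the class of the Schur polynomial of \<open>\<mu>\<close> to that of the conjugate partition,
  for every \<open>\<mu>\<close> with at most \<open>N\<close> parts and largest part at most \<open>k\<close>.\<close>

definition transposes :: "nat \<Rightarrow> nat \<Rightarrow> (qpoly set \<Rightarrow> qpoly set) \<Rightarrow> bool" where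
  "transposes N k f \<longleftrightarrow> (\<forall>\<mu>. partition_le N \<mu> \<and> \<mu> 0 \<le> k \<longrightarrow>
     f (schur_class N k \<mu>) = schur_class k N (conj_part \<mu>))"

end

theory Submission
  imports Defs "HOL-Computational_Algebra.Formal_Power_Series"
begin

text \<open>
  Modulo \<open>fusion_ideal_bar n l\<close> the elementary and complete symmetric polynomials satisfy
  \<open>e\<^sub>n = 1\<close>, \<open>h\<^sub>l = 1\<close> and \<open>h\<^sub>l\<^sub>+\<^sub>1 = ... = h\<^sub>l\<^sub>+\<^sub>n\<^sub>-\<^sub>1 = 0\<close>, and of course \<open>e\<^sub>m = 0\<close> for \<open>m > n\<close>. These relations
  generate the ideal if \<open>n \<ge> 2\<close>. On the one hand, hook partitions show that it contains
  the listed \<open>h\<close>s (\<open>hsym_mem_fusion_ideal\<close>). On the other hand, the relations make the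
  sequence of the \<open>h\<close>s periodic up to sign with period \<open>n + l\<close> (\<open>hsym_period\<close>); if
  \<open>\<mu>\<^sub>1 - \<mu>\<^sub>n = l + 1\<close>, the first and last row of the Jacobi-Trudi matrix of \<open>\<mu>\<close> differ by one
  period, so the Schur polynomial of \<open>\<mu>\<close> vanishes (\<open>schur_generator_mem\<close>).

  For \<open>n = N\<close>, \<open>l = k\<close> the relations say \<open>e\<^sub>N = 1\<close>, \<open>e\<^sub>m = 0\<close> for \<open>m > N\<close>, and \<open>h\<^sub>k = 1\<close>, \<open>h\<^sub>m = 0\<close> for
  \<open>k < m < N + k\<close>; for \<open>n = k\<close>, \<open>l = N\<close> they say the same with \<open>e\<close> and \<open>h\<close> exchanged, as far as indices
  below \<open>N + k\<close> are concerned. As \<open>e\<^sub>1, ..., e\<^sub>N\<close> are free generators of the symmetric polynomials in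
  \<open>N\<close> variables (\<open>esym_independent\<close>, \<open>esym_generates\<close>), there is a homomorphism \<open>dual_hom N k\<close> that sends each
  \<open>e\<^sub>i\<close> to the \<open>h\<^sub>i\<close> in \<open>k\<close> variables. Modulo the relations it sends \<open>e\<^sub>m\<close> to \<open>h\<^sub>m\<close> and \<open>h\<^sub>m\<close> to \<open>e\<^sub>m\<close> for all
  \<open>m < N + k\<close> (\<open>dual_hom_esym\<close>, \<open>dual_hom_hsym\<close>). So it respects the ideals, and \<open>dual_hom k N\<close> is its
  inverse (\<open>dual_hom_inverse\<close>). Since the Jacobi-Trudi matrix of a partition in the \<open>N\<close> by \<open>k\<close>
  rectangle has no index beyond \<open>N + k - 1\<close>, the Schur polynomial of \<open>\<mu>\<close> goes to the dual Jacobi-Trudi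
  determinant for the conjugate partition, that is, to the conjugate Schur polynomial
  (\<open>dual_jacobi_trudi\<close>, \<open>dual_hom_schur\<close>).

  The images of these Schur polynomials determine a linear map because they span: every symmetric
  polynomial is a combination of Jacobi-Trudi determinants with arbitrary row indices
  (\<open>sym_expansion\<close>, a form of Jacobi's bialternant formula), and periodicity reduces each of these to
  zero or to a signed Schur polynomial of a partition in the rectangle (\<open>hdet_straighten\<close>).
\<close>

section \<open>Determinants of related matrices\<close>

text \<open>Every determinant is a polynomial in the entries, so any relation compatible with the ring
  operations passes from entries to determinants. This is used with three relations: membership in
  a subring, congruence modulo an ideal of a subring, and the graph of a homomorphism that is
  defined only on a subring.\<close>
lemma det_closed_rel:
  fixes R :: "qpoly \<Rightarrow> qpoly \<Rightarrow> bool"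
  assumes "R 1 1"
    and "\<And>x y x' y'. R x y \<Longrightarrow> R x' y' \<Longrightarrow> R (x + x') (y + y')"
    and "\<And>x y x' y'. R x y \<Longrightarrow> R x' y' \<Longrightarrow> R (x * x') (y * y')"
    and "\<And>x y. R x y \<Longrightarrow> R (- x) (- y)"
    and "\<And>i j. i < n \<Longrightarrow> j < n \<Longrightarrow> R (f i j) (g i j)"
  shows "R (det (mat n n (\<lambda>(i,j). f i j))) (det (mat n n (\<lambda>(i,j). g i j)))"
proof -
  have R0: "R 0 0" using assms(2)[OF assms(1) assms(4)[OF assms(1)]] by simp
  have prod: "R (prod u A) (prod v A)" if "finite A" "\<And>i. i \<in> A \<Longrightarrow> R (u i) (v i)"
    for A :: "nat set" and u v
    using that by (induction rule: finite_induct) (auto intro: assms)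
  have sum: "R (sum u A) (sum v A)" if "finite A" "\<And>i. i \<in> A \<Longrightarrow> R (u i) (v i)"
    for A :: "(nat \<Rightarrow> nat) set" and u v
    using that by (induction rule: finite_induct) (auto intro: assms R0)
  have sg: "R (signof p) (signof p)" for p :: "nat \<Rightarrow> nat"
    using assms(1,4) by (auto simp: sign_def)
  have "R (\<Sum>p\<in>{p. p permutes {0..<n}}. signof p * (\<Prod>i=0..<n. f i (p i)))
          (\<Sum>p\<in>{p. p permutes {0..<n}}. signof p * (\<Prod>i=0..<n. g i (p i)))"
    by (intro sum assms(3) sg prod assms(5)) (auto simp: finite_permutations permutes_in_image)
  moreover have "det (mat n n (\<lambda>(i,j). f i j)) = (\<Sum>p\<in>{p. p permutes {0..<n}}. signof p * (\<Prod>i=0..<n. f i (p i)))" for f :: "nat \<Rightarrow> nat \<Rightarrow> qpoly"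
    by (subst det_def'[of _ n]) (auto intro!: sum.cong prod.cong simp: permutes_in_image)
  ultimately show ?thesis by (simp only:)
qed

section \<open>The dual Jacobi-Trudi identity\<close>

lemma conj_part_le: "partition_le N \<mu> \<Longrightarrow> conj_part \<mu> j \<le> N"
  unfolding conj_part_def
  by (rule order.trans[OF card_mono[of "{..<N}"]]) (auto simp: partition_le_def not_less[symmetric])

text \<open>Walk along the boundary of the Young diagram of \<open>\<mu>\<close> inside an \<open>N\<close> by \<open>k\<close> rectangle and number
  the \<open>N + k\<close> steps from \<open>0\<close>: the vertical step of row \<open>i\<close> has number \<open>\<mu> i + (N - 1 - i)\<close>, the
  horizontal step of column \<open>j\<close> has number \<open>N + j - conj_part \<mu> j\<close>. So the first \<open>N\<close> values list
  the rows of the determinant in the \<open>h\<close>s, and the last \<open>k\<close> values list the rows of the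
  complementary determinant in the \<open>e\<close>s.\<close>
definition edge_perm :: "nat \<Rightarrow> (nat \<Rightarrow> nat) \<Rightarrow> nat \<Rightarrow> nat" where
  "edge_perm N \<mu> i = (if i < N then \<mu> i + (N - 1 - i) else i - conj_part \<mu> (i - N))"

text \<open>The last box of the last nonzero row is always a removable corner; removing it lowers one row
  and one column by one.\<close>
lemma remove_last_box:
  assumes \<mu>: "partition_le N \<mu>" "\<mu> 0 \<le> k" and nz: "0 < (\<Sum>i<N. \<mu> i)"
  obtains a b \<nu> where "a < N" "b < k" "\<mu> a = Suc b" "\<nu> = \<mu>(a := b)" "partition_le N \<nu>" "\<nu> 0 \<le> k"
    "conj_part \<mu> b = Suc a" "conj_part \<nu> = (conj_part \<mu>)(b := a)"
proof -
  have anti: "\<mu> j \<le> \<mu> i" if "i \<le> j" for i j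
    using \<mu>(1) that by (auto simp: partition_le_def antimono_def)
  define a where "a = Max {i. i < N \<and> 0 < \<mu> i}"
  have ne: "{i. i < N \<and> 0 < \<mu> i} \<noteq> {}"
  proof
    assume "{i. i < N \<and> 0 < \<mu> i} = {}"
    hence "(\<Sum>i<N. \<mu> i) = 0" by (intro sum.neutral) auto
    thus False using nz by simp
  qed
  have a: "a < N" "0 < \<mu> a" using Max_in[OF _ ne] by (auto simp: a_def)
  have z: "\<mu> i = 0" if "a < i" for i
  proof (cases "i < N")
    case True
    show ?thesis
    proof (rule ccontr)
      assume "\<mu> i \<noteq> 0"
      hence "i \<le> a" unfolding a_def using True by (intro Max_ge) auto
      thus False using that by simp
    qed
  qed (use \<mu>(1) in \<open>auto simp: partition_le_def\<close>)
  define b where "b = \<mu> a - 1"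
  have b: "\<mu> a = Suc b" using a by (simp add: b_def)
  define \<nu> where "\<nu> = \<mu>(a := b)"
  have S: "b < \<mu> i \<longleftrightarrow> i \<le> a" for i
  proof
    assume "b < \<mu> i" thus "i \<le> a" using z[of i] by (cases "a < i") auto
  next
    assume "i \<le> a" thus "b < \<mu> i" using anti[of i a] b by simp
  qed
  have "{i. b < \<mu> i} = {..a}" by (simp add: S atMost_def)
  hence "conj_part \<mu> b = Suc a" by (simp add: conj_part_def)
  moreover have "conj_part \<nu> = (conj_part \<mu>)(b := a)"
  proof
    fix j
    show "conj_part \<nu> j = ((conj_part \<mu>)(b := a)) j"
    proof (cases "j = b")
      case True
      have "b < \<nu> i \<longleftrightarrow> i < a" for i
      proof (cases "i = a")
        case True
        thus ?thesis by (simp add: \<nu>_def)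
      next
        case False
        thus ?thesis using S[of i] by (simp add: \<nu>_def order_less_le)
      qed
      hence "{i. b < \<nu> i} = {..<a}" by (simp add: lessThan_def)
      thus ?thesis using True by (simp add: conj_part_def)
    next
      case False
      hence "{i. j < \<nu> i} = {i. j < \<mu> i}" using b unfolding \<nu>_def by auto
      thus ?thesis using False by (simp add: conj_part_def)
    qed
  qed
  moreover have "partition_le N \<nu>"
    unfolding partition_le_def \<nu>_def antimono_def
  proof (intro conjI allI impI)
    fix i j :: nat assume "i \<le> j"
    thus "(\<mu>(a := b)) j \<le> (\<mu>(a := b)) i"
      using anti[of i j] b z[of j] by auto
  qed (use \<mu>(1) a in \<open>auto simp: partition_le_def\<close>)
  moreover have "\<nu> 0 \<le> k" "b < k" using \<mu>(2) anti[of 0 a] b by (auto simp: \<nu>_def)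
  ultimately show thesis using that[of a b \<nu>] a(1) b \<nu>_def by blast
qed

text \<open>Removing a corner exchanges two consecutive boundary steps, one vertical and one horizontal.
  Hence \<open>edge_perm\<close> is a permutation, and its sign relative to the empty partition counts boxes.\<close>
lemma edge_perm_remove_box:
  assumes "a < N" "\<mu> a = Suc b" "conj_part \<mu> b = Suc a" "conj_part (\<mu>(a := b)) = (conj_part \<mu>)(b := a)"
  shows "edge_perm N \<mu> = edge_perm N (\<mu>(a := b)) \<circ> Transposition.transpose a (N + b)"
  using assms by (auto simp: edge_perm_def fun_eq_iff Transposition.transpose_def)

lemma edge_perm_induct [consumes 2, case_names zero box]:
  assumes "partition_le N \<mu>" "\<mu> 0 \<le> k"
    and base: "P (\<lambda>_. 0)"
    and step: "\<And>\<mu> a b. \<lbrakk>a < N; b < k; \<mu> a = Suc b; conj_part \<mu> b = Suc a; 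
        conj_part (\<mu>(a := b)) = (conj_part \<mu>)(b := a); P (\<mu>(a := b))\<rbrakk> \<Longrightarrow> P \<mu>"
  shows "P \<mu>"
  using assms(1,2)
proof (induction "\<Sum>i<N. \<mu> i" arbitrary: \<mu> rule: less_induct)
  case (less \<mu>)
  show ?case
  proof (cases "(\<Sum>i<N. \<mu> i) = 0")
    case True
    hence "\<mu> i = 0" for i using less.prems(1) by (cases "i < N") (auto simp: partition_le_def)
    hence "\<mu> = (\<lambda>_. 0)" by (simp add: fun_eq_iff)
    thus ?thesis using base by simp
  next
    case False
    then obtain a b \<nu> where ab: "a < N" "b < k" "\<mu> a = Suc b" "\<nu> = \<mu>(a := b)" "partition_le N \<nu>" "\<nu> 0 \<le> k"
      "conj_part \<mu> b = Suc a" "conj_part \<nu> = (conj_part \<mu>)(b := a)"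
      using remove_last_box[OF less.prems] by blast
    have "(\<Sum>i<N. \<nu> i) < (\<Sum>i<N. \<mu> i)"
      using ab(1,3,4) by (intro sum_strict_mono_ex1) auto
    from less.hyps[OF this ab(5,6)] have "P (\<mu>(a := b))" unfolding ab(4) .
    thus ?thesis by (intro step[OF ab(1-3,7)] ab(8)[unfolded ab(4)])
  qed
qed

lemma conj_part_zero [simp]: "conj_part (\<lambda>_. 0) = (\<lambda>_. 0)"
  by (simp add: conj_part_def fun_eq_iff)

lemma edge_perm_zero_bij: "bij_betw (edge_perm N (\<lambda>_. 0)) {..<N + k} {..<N + k}"
  by (rule bij_betw_byWitness[where f' = "edge_perm N (\<lambda>_. 0)"])
     (auto simp: edge_perm_def)

lemma bij_edge_perm:
  assumes "partition_le N \<mu>" "\<mu> 0 \<le> k"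
  shows "bij_betw (edge_perm N \<mu>) {..<N + k} {..<N + k}"
  using assms
proof (induction rule: edge_perm_induct)
  case zero show ?case by (rule edge_perm_zero_bij)
next
  case 2: (box \<mu> a b)
  have "bij_betw (Transposition.transpose a (N + b)) {..<N + k} {..<N + k}"
    by (rule permutes_imp_bij, rule permutes_swap_id) (use 2 in auto)
  from bij_betw_trans[OF this 2(6)] show ?case
    unfolding edge_perm_remove_box[OF 2(1,3,4,5)] .
qed

text \<open>For a unitriangular matrix only the sign of the row and column permutations is left.\<close>
lemma det_edge_perm:
  fixes h :: "nat \<Rightarrow> nat \<Rightarrow> 'a :: comm_ring_1"
  assumes "partition_le N \<mu>" "\<mu> 0 \<le> k"
    and h: "\<And>i. h i i = 1" "\<And>i j. j < i \<Longrightarrow> h i j = 0"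
  shows "det (mat (N + k) (N + k) (\<lambda>(i,j). h (edge_perm N (\<lambda>_. 0) i) (edge_perm N \<mu> j)))
         = (-1) ^ (\<Sum>j<k. conj_part \<mu> j)"
  using assms(1,2)
proof (induction rule: edge_perm_induct)
  case zero
  let ?T = "N + k" and ?w = "edge_perm N (\<lambda>_. 0)"
  define p where "p i = (if i < ?T then ?w i else i)" for i
  have "bij_betw p {..<?T} {..<?T}"
    by (subst bij_betw_cong[of _ _ ?w]) (auto simp: p_def edge_perm_zero_bij)
  hence p: "p permutes {0..<?T}"
    by (intro bij_imp_permutes) (auto simp: p_def lessThan_atLeast0)
  define A where "A = mat ?T ?T (\<lambda>(i,j). h i j)"
  have A: "A \<in> carrier_mat ?T ?T" by (simp add: A_def)
  define B where "B = mat ?T ?T (\<lambda>(i,j). A $$ (p i, j))"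
  have B: "B \<in> carrier_mat ?T ?T" by (simp add: B_def)
  have pl: "p i < ?T" if "i < ?T" for i using permutes_in_image[OF p, of i] that by auto
  have dA: "det A = 1"
  proof -
    have "det A = prod_list (diag_mat A)"
      by (rule det_upper_triangular[OF _ A]) (auto simp: A_def h)
    also have "diag_mat A = replicate ?T 1" by (auto simp: diag_mat_def A_def h intro!: nth_equalityI)
    finally show ?thesis by simp
  qed
  have "det B = signof p * det A"
    unfolding B_def by (rule det_permute_rows[OF A p])
  moreover have "det (mat ?T ?T (\<lambda>(i,j). transpose_mat B $$ (p i, j))) = signof p * det (transpose_mat B)"
    by (rule det_permute_rows[OF _ p]) (use B in auto)
  moreover have "transpose_mat (mat ?T ?T (\<lambda>(i,j). h (?w i) (?w j))) = mat ?T ?T (\<lambda>(i,j). transpose_mat B $$ (p i, j))"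
    using pl by (intro eq_matI) (auto simp: B_def A_def p_def)
  moreover have "signof p * signof p = (1::'a)" by (auto simp: sign_def)
  ultimately have "det (transpose_mat (mat ?T ?T (\<lambda>(i,j). h (?w i) (?w j)))) = 1"
    using dA det_transpose[OF B] by (simp flip: mult.assoc)
  thus ?case by (subst (asm) det_transpose[of _ ?T]) auto
next
  case 2: (box \<mu> a b)
  let ?T = "N + k" and ?w = "edge_perm N (\<lambda>_. 0)"
  define A where "A = (\<lambda>\<mu>. mat ?T ?T (\<lambda>(i,j). h (?w i) (edge_perm N \<mu> j)))"
  have "A \<mu> = swapcols a (N + b) (A (\<mu>(a := b)))"
    using edge_perm_remove_box[of a N \<mu> b] 2(1-5)
    by (intro eq_matI) (auto simp: A_def mat_swapcols_def Transposition.transpose_def)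
  hence "det (A \<mu>) = - det (A (\<mu>(a := b)))"
    using 2(1,2) by (simp add: det_swapcols[of _ ?T] A_def)
  moreover have "(\<Sum>j<k. conj_part \<mu> j) = Suc (\<Sum>j<k. conj_part (\<mu>(a := b)) j)"
  proof -
    have "(\<Sum>j<k. conj_part \<mu> j) = conj_part \<mu> b + (\<Sum>j\<in>{..<k}-{b}. conj_part \<mu> j)"
      using 2(2) by (subst sum.remove[of _ b]) auto
    moreover have "(\<Sum>j<k. conj_part (\<mu>(a := b)) j) = conj_part (\<mu>(a := b)) b + (\<Sum>j\<in>{..<k}-{b}. conj_part (\<mu>(a := b)) j)"
      using 2(2) by (subst sum.remove[of _ b]) auto
    moreover have "(\<Sum>j\<in>{..<k}-{b}. conj_part (\<mu>(a := b)) j) = (\<Sum>j\<in>{..<k}-{b}. conj_part \<mu> j)"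
      by (rule sum.cong) (auto simp: 2(5))
    ultimately show ?thesis using 2(4,5) by simp
  qed
  ultimately show ?case using 2(6) by (simp only: A_def power_Suc mult_minus1)
qed

text \<open>Jacobi's identity for complementary minors. The hypothesis says that the matrices
  \<open>(a (j - i))\<close> and \<open>((-1) ^ (i + j) * b (j - i))\<close> are inverse to each other. After permuting rows and columns by
  the boundary words of the empty partition and of \<open>\<mu>\<close>, the determinant in the \<open>a\<close>s is the upper
  left \<open>N\<close> by \<open>N\<close> minor of the first matrix, and the one in the \<open>b\<close>s is the lower right
  \<open>k\<close> by \<open>k\<close> minor of the second.\<close>
theorem dual_jacobi_trudi:
  fixes a b :: "int \<Rightarrow> 'a :: idom"
  assumes neg: "\<And>m. m < 0 \<Longrightarrow> a m = 0" "\<And>m. m < 0 \<Longrightarrow> b m = 0"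
    and one: "a 0 = 1" "b 0 = 1"
    and conv: "\<And>m. m > 0 \<Longrightarrow> (\<Sum>i\<le>m. (-1) ^ i * a (int (m - i)) * b (int i)) = 0"
    and \<mu>: "partition_le N \<mu>" "\<mu> 0 \<le> k"
  shows "det (mat N N (\<lambda>(i,j). a (int (\<mu> i) - int i + int j)))
       = det (mat k k (\<lambda>(i,j). b (int (conj_part \<mu> i) - int i + int j)))"
proof -
  let ?T = "N + k"
  define w0 where "w0 = edge_perm N (\<lambda>_. 0)"
  define w where "w = edge_perm N \<mu>"
  define H where "H i j = a (int j - int i)" for i j :: nat
  define E where "E i j = (-1) ^ (i + j) * b (int j - int i)" for i j :: nat
  have bw: "bij_betw w {..<?T} {..<?T}" unfolding w_def by (rule bij_edge_perm[OF \<mu>])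
  have bw0: "bij_betw w0 {..<?T} {..<?T}" unfolding w0_def by (rule edge_perm_zero_bij)
  have HE: "(\<Sum>l<?T. H i l * E l j) = (if i = j then 1 else 0)" if "i < ?T" "j < ?T" for i j
  proof (cases "i \<le> j")
    case True
    have "(\<Sum>l<?T. H i l * E l j) = (\<Sum>l\<in>{i..j}. H i l * E l j)"
      using that True by (intro sum.mono_neutral_right) (auto simp: H_def E_def neg)
    also have "\<dots> = (\<Sum>s\<le>j - i. (-1) ^ s * a (int (j - i - s)) * b (int s))"
    proof (rule sum.reindex_bij_witness[of _ "\<lambda>s. j - s" "\<lambda>l. j - l"])
      fix l assume l: "l \<in> {i..j}"
      have "(-1 :: 'a) ^ (l + j) = (-1) ^ (j - l)"
        using l by (simp add: minus_one_power_iff)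
      thus "(-1) ^ (j - l) * a (int (j - i - (j - l))) * b (int (j - l)) = H i l * E l j"
        using l by (simp add: H_def E_def of_nat_diff)
    qed (use True in auto)
    also have "\<dots> = (if i = j then 1 else 0)"
      using conv[of "j - i"] True one by auto
    finally show ?thesis .
  next
    case False
    have "H i l * E l j = 0" for l
    proof (cases "l < i")
      case True
      thus ?thesis using neg(1)[of "int l - int i"] by (simp add: H_def)
    next
      case l: False
      thus ?thesis using False neg(2)[of "int j - int l"] by (simp add: E_def)
    qed
    hence "(\<Sum>l<?T. H i l * E l j) = 0" by (intro sum.neutral ballI)
    thus ?thesis using False by simp
  qed
  define A where "A = mat ?T ?T (\<lambda>(i,j). H (w0 i) (w j))"
  define B where "B = mat ?T ?T (\<lambda>(i,j). E (w i) (w0 j))"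
  have AB: "(\<Sum>l<?T. A $$ (i,l) * B $$ (l,j)) = (if i = j then 1 else 0)" if "i < ?T" "j < ?T" for i j
  proof -
    have "(\<Sum>l<?T. A $$ (i,l) * B $$ (l,j)) = (\<Sum>l<?T. H (w0 i) (w l) * E (w l) (w0 j))"
      using that by (intro sum.cong) (auto simp: A_def B_def)
    also have "\<dots> = (\<Sum>l<?T. H (w0 i) l * E l (w0 j))"
      using sum.reindex_bij_betw[OF bw, of "\<lambda>l. H (w0 i) l * E l (w0 j)"] .
    also have "\<dots> = (if w0 i = w0 j then 1 else 0)"
      by (rule HE) (use bw0 that in \<open>auto simp: bij_betw_def\<close>)
    also have "w0 i = w0 j \<longleftrightarrow> i = j"
      using bw0 that by (auto simp: bij_betw_def inj_on_def)
    finally show ?thesis .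
  qed
  define A11 where "A11 = mat N N (\<lambda>(i,j). A $$ (i,j))"
  define A21 where "A21 = mat k N (\<lambda>(i,j). A $$ (N + i,j))"
  define B12 where "B12 = mat N k (\<lambda>(i,j). B $$ (i,N + j))"
  define B22 where "B22 = mat k k (\<lambda>(i,j). B $$ (N + i,N + j))"
  \<comment> \<open>Replacing the left block column of \<open>B\<close> by that of the identity turns \<open>A * B = 1\<close> into
    \<open>A * M = L\<close>, whose determinants are \<open>det A * det B22\<close> and \<open>det A11\<close>.\<close>
  define M where "M = four_block_mat (1\<^sub>m N) B12 (0\<^sub>m k N) B22"
  define L where "L = four_block_mat A11 (0\<^sub>m N k) A21 (1\<^sub>m k)"
  have AM: "A * M = L"
  proof (rule eq_matI)
    fix i j assume "i < dim_row L" "j < dim_col L"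
    hence ij: "i < ?T" "j < ?T" by (auto simp: L_def A11_def A21_def)
    have "(A * M) $$ (i,j) = (\<Sum>l<?T. A $$ (i,l) * M $$ (l,j))"
      using ij by (auto simp: A_def M_def B12_def B22_def scalar_prod_def lessThan_atLeast0 intro!: sum.cong)
    also have "\<dots> = L $$ (i,j)"
    proof (cases "j < N")
      case True
      have "(\<Sum>l<?T. A $$ (i,l) * M $$ (l,j)) = (\<Sum>l<?T. if l = j then A $$ (i,l) else 0)"
        using True by (intro sum.cong) (auto simp: M_def B12_def B22_def)
      thus ?thesis using True ij by (auto simp: L_def A11_def A21_def)
    next
      case False
      have "(\<Sum>l<?T. A $$ (i,l) * M $$ (l,j)) = (\<Sum>l<?T. A $$ (i,l) * B $$ (l,j))"
        using False ij by (intro sum.cong) (auto simp: M_def B12_def B22_def)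
      thus ?thesis using False ij AB[OF ij] by (auto simp: L_def A11_def A21_def)
    qed
    finally show "(A * M) $$ (i,j) = L $$ (i,j)" .
  qed (auto simp: A_def M_def L_def A11_def A21_def B12_def B22_def)
  have dAM: "det (A * M) = det A * det M"
    by (rule det_mult[of _ ?T]) (auto simp: A_def M_def B12_def B22_def)
  have dM: "det M = det B22"
    unfolding M_def by (subst det_four_block_mat_lower_left_zero[of _ N _ k]) (auto simp: B12_def B22_def)
  have dL: "det L = det A11"
    unfolding L_def by (subst det_four_block_mat_upper_right_zero[of _ N _ k]) (auto simp: A11_def A21_def)
  have dA: "det A = (-1) ^ (\<Sum>j<k. conj_part \<mu> j)"
    unfolding A_def w0_def w_def by (rule det_edge_perm[OF \<mu>]) (auto simp: H_def one neg)
  have dA11: "det A11 = det (mat N N (\<lambda>(i,j). a (int (\<mu> i) - int i + int j)))"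
  proof -
    have "transpose_mat A11 = mat N N (\<lambda>(i,j). a (int (\<mu> i) - int i + int j))"
      by (intro eq_matI) (auto simp: A11_def A_def w0_def w_def edge_perm_def H_def of_nat_diff intro!: arg_cong[of _ _ a])
    thus ?thesis using det_transpose[of A11 N] by (simp add: A11_def)
  qed
  \<comment> \<open>The signs of the inverse matrix contribute \<open>(-1) ^ (conj_part \<mu> i)\<close> in row \<open>i\<close>; the rest of the
    sign cancels because a permutation preserves the sum of all indices.\<close>
  have dB22: "det B22 = (-1) ^ (\<Sum>j<k. conj_part \<mu> j) * det (mat k k (\<lambda>(i,j). b (int (conj_part \<mu> i) - int i + int j)))"
  proof -
    have B22: "B22 $$ (i,j) = (-1) ^ (i + j + conj_part \<mu> i) * b (int (conj_part \<mu> i) - int i + int j)"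
      if "i < k" "j < k" for i j
    proof -
      have c: "conj_part \<mu> i \<le> N" by (rule conj_part_le[OF \<mu>(1)])
      have "(-1 :: 'a) ^ (N + i - conj_part \<mu> i + (N + j)) = (-1) ^ (i + j + conj_part \<mu> i)"
      proof -
        have "even (N + i - conj_part \<mu> i + (N + j)) \<longleftrightarrow> even (i + j + conj_part \<mu> i)"
        proof -
          obtain d where "N = conj_part \<mu> i + d" using le_Suc_ex[OF c] by blast
          thus ?thesis by simp argo
        qed
        thus ?thesis by (simp only: minus_one_power_iff)
      qed
      thus ?thesis using that c
        by (simp add: B22_def B_def w0_def w_def edge_perm_def E_def of_nat_diff) (simp add: algebra_simps)
    qed
    have "det B22 = (\<Sum>p | p permutes {0..<k}. signof p * (\<Prod>i = 0..<k. B22 $$ (i, p i)))"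
      by (rule det_def') (simp add: B22_def)
    also have "\<dots> = (\<Sum>p | p permutes {0..<k}. (-1) ^ (\<Sum>j<k. conj_part \<mu> j) *
        (signof p * (\<Prod>i = 0..<k. b (int (conj_part \<mu> i) - int i + int (p i)))))"
    proof (rule sum.cong[OF refl], safe)
      fix p assume p: "p permutes {0..<k}"
      have "(\<Prod>i = 0..<k. B22 $$ (i, p i)) =
        (\<Prod>i = 0..<k. (-1) ^ (i + p i + conj_part \<mu> i) * b (int (conj_part \<mu> i) - int i + int (p i)))"
        using p by (intro prod.cong refl B22) (auto simp: permutes_in_image)
      also have "\<dots> = (-1) ^ (\<Sum>i = 0..<k. i + p i + conj_part \<mu> i) *
          (\<Prod>i = 0..<k. b (int (conj_part \<mu> i) - int i + int (p i)))"
        by (simp add: prod.distrib power_sum)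
      also have "(\<Sum>i = 0..<k. i + p i + conj_part \<mu> i) = 2 * (\<Sum>i = 0..<k. i) + (\<Sum>i<k. conj_part \<mu> i)"
        using sum.permute[OF p, of "\<lambda>i. i"] by (simp add: sum.distrib lessThan_atLeast0 comp_def)
      also have "(-1 :: 'a) ^ \<dots> = (-1) ^ (\<Sum>i<k. conj_part \<mu> i)"
        by (simp add: power_add power_mult)
      finally show "signof p * (\<Prod>i = 0..<k. B22 $$ (i, p i)) = (-1) ^ (\<Sum>j<k. conj_part \<mu> j) *
        (signof p * (\<Prod>i = 0..<k. b (int (conj_part \<mu> i) - int i + int (p i))))"
        by (simp only: mult.left_commute)
    qed
    also have "\<dots> = (-1) ^ (\<Sum>j<k. conj_part \<mu> j) * det (mat k k (\<lambda>(i,j). b (int (conj_part \<mu> i) - int i + int j)))"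
      by (subst det_def'[of _ k]) (auto simp: permutes_in_image sum_distrib_left intro!: sum.cong prod.cong)
    finally show ?thesis .
  qed
  have "det A11 = det A * det B22"
    using dAM unfolding AM dM dL .
  thus ?thesis
    unfolding dA11 dA dB22 by (simp flip: mult.assoc power_add mult_2)
qed

section \<open>Evaluation of polynomials\<close>

abbreviation const :: "rat \<Rightarrow> qpoly" where
  "const c \<equiv> Poly_Mapping.single 0 c"

definition var :: "nat \<Rightarrow> qpoly" where
  "var i = Poly_Mapping.single (Poly_Mapping.single i 1) 1"

definition mon_eval :: "(nat \<Rightarrow> qpoly) \<Rightarrow> (nat \<Rightarrow>\<^sub>0 nat) \<Rightarrow> qpoly" where
  "mon_eval r a = (\<Prod>i\<in>Poly_Mapping.keys a. r i ^ Poly_Mapping.lookup a i)"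

definition poly_eval :: "(nat \<Rightarrow> qpoly) \<Rightarrow> qpoly \<Rightarrow> qpoly" where
  "poly_eval r p = (\<Sum>a\<in>Poly_Mapping.keys p. const (Poly_Mapping.lookup p a) * mon_eval r a)"

lemma sum_monomials:
  "(p :: 'a \<Rightarrow>\<^sub>0 'b :: comm_monoid_add) = (\<Sum>a\<in>Poly_Mapping.keys p. Poly_Mapping.single a (Poly_Mapping.lookup p a))"
proof (rule poly_mapping_eqI)
  fix b
  have "Poly_Mapping.lookup p b = (if b \<in> Poly_Mapping.keys p then Poly_Mapping.lookup p b else 0)"
    by (simp add: in_keys_iff)
  thus "Poly_Mapping.lookup p b = Poly_Mapping.lookup (\<Sum>a\<in>Poly_Mapping.keys p. Poly_Mapping.single a (Poly_Mapping.lookup p a)) b"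
    by (simp add: lookup_sum lookup_single when_def)
qed

lemma mon_eval_superset:
  "finite S \<Longrightarrow> Poly_Mapping.keys a \<subseteq> S \<Longrightarrow> mon_eval r a = (\<Prod>i\<in>S. r i ^ Poly_Mapping.lookup a i)"
  unfolding mon_eval_def by (rule prod.mono_neutral_left) (auto simp: in_keys_iff)

lemma mon_eval_add: "mon_eval r (a + b) = mon_eval r a * mon_eval r b"
proof -
  let ?S = "Poly_Mapping.keys a \<union> Poly_Mapping.keys b"
  show ?thesis
    using Poly_Mapping.keys_add[of a b]
    by (simp add: mon_eval_superset[of ?S] lookup_add power_add prod.distrib)
qed

lemma mon_eval_zero [simp]: "mon_eval r 0 = 1"
  by (simp add: mon_eval_def)

lemma poly_eval_superset:
  "finite S \<Longrightarrow> Poly_Mapping.keys p \<subseteq> S \<Longrightarrow>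
   poly_eval r p = (\<Sum>a\<in>S. const (Poly_Mapping.lookup p a) * mon_eval r a)"
  unfolding poly_eval_def by (rule sum.mono_neutral_left) (auto simp: in_keys_iff)

lemma poly_eval_add: "poly_eval r (p + q) = poly_eval r p + poly_eval r q"
proof -
  let ?S = "Poly_Mapping.keys p \<union> Poly_Mapping.keys q"
  show ?thesis
    using Poly_Mapping.keys_add[of p q]
    by (simp add: poly_eval_superset[of ?S] lookup_add single_add distrib_right sum.distrib)
qed

lemma poly_eval_zero [simp]: "poly_eval r 0 = 0"
  by (simp add: poly_eval_def)

lemma poly_eval_single: "poly_eval r (Poly_Mapping.single a c) = const c * mon_eval r a"
  by (cases "c = 0") (simp_all add: poly_eval_def)

lemma poly_eval_const [simp]: "poly_eval r (const c) = const c"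
  by (simp add: poly_eval_single)

lemma poly_eval_var [simp]: "poly_eval r (var i) = r i"
  by (simp add: var_def poly_eval_single mon_eval_def)

lemma poly_eval_sum: "poly_eval r (\<Sum>i\<in>A. f i) = (\<Sum>i\<in>A. poly_eval r (f i))"
  by (induction A rule: infinite_finite_induct) (simp_all add: poly_eval_add)

lemma poly_eval_mult: "poly_eval r (p * q) = poly_eval r p * poly_eval r q"
proof -
  have "poly_eval r (p * q) =
    (\<Sum>a\<in>Poly_Mapping.keys p. \<Sum>b\<in>Poly_Mapping.keys q.
       poly_eval r (Poly_Mapping.single a (Poly_Mapping.lookup p a) * Poly_Mapping.single b (Poly_Mapping.lookup q b)))"
    by (subst (2) sum_monomials, subst (3) sum_monomials) (simp only: sum_product poly_eval_sum)
  also have "\<dots> = (\<Sum>a\<in>Poly_Mapping.keys p. \<Sum>b\<in>Poly_Mapping.keys q.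
       (const (Poly_Mapping.lookup p a) * mon_eval r a) * (const (Poly_Mapping.lookup q b) * mon_eval r b))"
  proof (intro sum.cong refl)
    fix a b
    have "const (Poly_Mapping.lookup p a * Poly_Mapping.lookup q b) = const (Poly_Mapping.lookup p a) * const (Poly_Mapping.lookup q b)"
      by (simp add: mult_single)
    thus "poly_eval r (Poly_Mapping.single a (Poly_Mapping.lookup p a) * Poly_Mapping.single b (Poly_Mapping.lookup q b))
       = (const (Poly_Mapping.lookup p a) * mon_eval r a) * (const (Poly_Mapping.lookup q b) * mon_eval r b)"
      by (simp only: mult_single poly_eval_single mon_eval_add mult_ac)
  qed
  also have "\<dots> = poly_eval r p * poly_eval r q"
    by (simp only: poly_eval_def sum_product)
  finally show ?thesis .
qed

lemma poly_eval_uminus: "poly_eval r (- p) = - poly_eval r p"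
  using poly_eval_add[of r p "- p"] by (simp add: eq_neg_iff_add_eq_0 add.commute)

lemma poly_eval_diff: "poly_eval r (p - q) = poly_eval r p - poly_eval r q"
  using poly_eval_add[of r p "- q"] by (simp add: poly_eval_uminus)

section \<open>Symmetric polynomials\<close>

definition vars_below :: "nat \<Rightarrow> qpoly set" where
  "vars_below n = {p. \<forall>a\<in>Poly_Mapping.keys p. Poly_Mapping.keys a \<subseteq> {..<n}}"

lemma vars_below_add: "p \<in> vars_below n \<Longrightarrow> q \<in> vars_below n \<Longrightarrow> p + q \<in> vars_below n"
  using Poly_Mapping.keys_add[of p q] by (auto simp: vars_below_def subset_iff)

lemma vars_below_uminus: "p \<in> vars_below n \<Longrightarrow> - p \<in> vars_below n"
  by (auto simp: vars_below_def in_keys_iff)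

lemma vars_below_mult: "p \<in> vars_below n \<Longrightarrow> q \<in> vars_below n \<Longrightarrow> p * q \<in> vars_below n"
  unfolding vars_below_def
proof safe
  fix a i assume p: "\<forall>a\<in>Poly_Mapping.keys p. Poly_Mapping.keys a \<subseteq> {..<n}"
    and q: "\<forall>a\<in>Poly_Mapping.keys q. Poly_Mapping.keys a \<subseteq> {..<n}"
    and "a \<in> Poly_Mapping.keys (p * q)" "i \<in> Poly_Mapping.keys a"
  then obtain b c where "b \<in> Poly_Mapping.keys p" "c \<in> Poly_Mapping.keys q" "a = b + c"
    using keys_mult[of p q] by auto
  thus "i < n" using p q Poly_Mapping.keys_add[of b c] \<open>i \<in> Poly_Mapping.keys a\<close> by blast
qed

lemma vars_below_const: "const c \<in> vars_below n"
  by (cases "c = 0") (auto simp: vars_below_def)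

lemma vars_below_var: "i < n \<Longrightarrow> var i \<in> vars_below n"
  by (auto simp: vars_below_def var_def)

abbreviation rename_vars :: "(nat \<Rightarrow> nat) \<Rightarrow> qpoly \<Rightarrow> qpoly" where
  "rename_vars \<sigma> \<equiv> poly_eval (\<lambda>i. var (\<sigma> i))"

lemma var_power: "var i ^ k = Poly_Mapping.single (Poly_Mapping.single i k) 1"
  by (induction k) (simp_all add: var_def mult_single single_add[symmetric])

lemma prod_single_one:
  "(\<Prod>i\<in>A. Poly_Mapping.single (f i) (1 :: rat)) = Poly_Mapping.single (\<Sum>i\<in>A. (f i :: nat \<Rightarrow>\<^sub>0 nat)) 1"
  by (induction A rule: infinite_finite_induct) (simp_all add: mult_single)

text \<open>Permuting variables and permuting exponent vectors are the same operation. Symmetry thereby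
  becomes invariance under ring homomorphisms, and the symmetric polynomials form a ring.\<close>
lemma lookup_rename_vars:
  assumes "bij \<sigma>"
  shows "Poly_Mapping.lookup (rename_vars \<sigma> p) b = Poly_Mapping.lookup p (Poly_Mapping.map_key \<sigma> b)"
proof -
  have inj: "inj \<sigma>" using assms by (rule bij_is_inj)
  define push where "push a = (\<Sum>i\<in>Poly_Mapping.keys a. Poly_Mapping.single (\<sigma> i) (Poly_Mapping.lookup a i))" for a :: "nat \<Rightarrow>\<^sub>0 nat"
  have lp: "Poly_Mapping.lookup (push a) (\<sigma> j) = Poly_Mapping.lookup a j" for a j
    using inj by (simp add: push_def lookup_sum lookup_single when_def inj_eq in_keys_iff)
  have push: "push a = b \<longleftrightarrow> a = Poly_Mapping.map_key \<sigma> b" for a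
  proof
    assume "push a = b"
    thus "a = Poly_Mapping.map_key \<sigma> b"
      using lp[of a] by (intro poly_mapping_eqI) (auto simp: map_key.rep_eq inj)
  next
    assume a: "a = Poly_Mapping.map_key \<sigma> b"
    show "push a = b"
    proof (rule poly_mapping_eqI)
      fix i
      obtain j where "i = \<sigma> j" using assms by (metis bij_pointE)
      thus "Poly_Mapping.lookup (push a) i = Poly_Mapping.lookup b i"
        using lp[of a j] a inj by (simp add: map_key.rep_eq)
    qed
  qed
  have "mon_eval (\<lambda>i. var (\<sigma> i)) a = Poly_Mapping.single (push a) 1" for a
    by (simp add: mon_eval_def var_power prod_single_one push_def)
  hence "rename_vars \<sigma> p = (\<Sum>a\<in>Poly_Mapping.keys p. Poly_Mapping.single (push a) (Poly_Mapping.lookup p a))"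
    by (simp add: poly_eval_def mult_single)
  thus ?thesis
    by (simp add: lookup_sum lookup_single when_def push in_keys_iff)
qed

lemma sym_polys_iff:
  "p \<in> sym_polys n \<longleftrightarrow> p \<in> vars_below n \<and> (\<forall>\<sigma>. \<sigma> permutes {..<n} \<longrightarrow> rename_vars \<sigma> p = p)"
  unfolding sym_polys_def vars_below_def mem_Collect_eq
  by (intro conj_cong refl all_cong1 imp_cong)
     (simp add: poly_mapping_eq_iff fun_eq_iff lookup_rename_vars permutes_bij)

lemma sym_add: "p \<in> sym_polys n \<Longrightarrow> q \<in> sym_polys n \<Longrightarrow> p + q \<in> sym_polys n"
  by (simp add: sym_polys_iff vars_below_add poly_eval_add)

lemma sym_mult: "p \<in> sym_polys n \<Longrightarrow> q \<in> sym_polys n \<Longrightarrow> p * q \<in> sym_polys n"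
  by (simp add: sym_polys_iff vars_below_mult poly_eval_mult)

lemma sym_uminus: "p \<in> sym_polys n \<Longrightarrow> - p \<in> sym_polys n"
  by (simp add: sym_polys_iff vars_below_uminus poly_eval_uminus)

lemma sym_diff: "p \<in> sym_polys n \<Longrightarrow> q \<in> sym_polys n \<Longrightarrow> p - q \<in> sym_polys n"
  using sym_add[of p n "- q"] by (simp add: sym_uminus)

lemma sym_const: "const c \<in> sym_polys n"
  by (simp add: sym_polys_iff vars_below_const)

lemma sym_zero: "0 \<in> sym_polys n"
  using sym_const[of 0 n] by simp

lemma sym_one: "1 \<in> sym_polys n"
  using sym_const[of 1 n] by (simp only: single_one)

lemma sym_sum: "(\<And>i. i \<in> A \<Longrightarrow> f i \<in> sym_polys n) \<Longrightarrow> sum f A \<in> sym_polys n"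
  by (induction A rule: infinite_finite_induct) (auto intro: sym_add sym_zero)

lemma sym_power: "p \<in> sym_polys n \<Longrightarrow> p ^ m \<in> sym_polys n"
  by (induction m) (auto intro: sym_mult sym_one)

lemma sym_prod: "(\<And>i. i \<in> A \<Longrightarrow> f i \<in> sym_polys n) \<Longrightarrow> prod f A \<in> sym_polys n"
  by (induction A rule: infinite_finite_induct) (auto intro: sym_mult sym_one)

lemma sym_det:
  "(\<And>i j. i < m \<Longrightarrow> j < m \<Longrightarrow> f i j \<in> sym_polys n) \<Longrightarrow> det (mat m m (\<lambda>(i,j). f i j)) \<in> sym_polys n"
  using det_closed_rel[of "\<lambda>x _. x \<in> sym_polys n" m f f]
  by (auto intro: sym_add sym_mult sym_uminus sym_one)

lemma sym_poly_eval:
  "(\<And>i. r i \<in> sym_polys n) \<Longrightarrow> poly_eval r p \<in> sym_polys n"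
  unfolding poly_eval_def mon_eval_def
  by (intro sym_sum sym_mult sym_prod sym_power sym_const)

section \<open>Complete and elementary symmetric polynomials\<close>

abbreviation monomials :: "nat \<Rightarrow> int \<Rightarrow> (nat \<Rightarrow>\<^sub>0 nat) set" where
  "monomials n m \<equiv> {a. Poly_Mapping.keys a \<subseteq> {..<n} \<and> int (\<Sum>i<n. Poly_Mapping.lookup a i) = m}"

lemma finite_monomials: "finite (monomials n m)"
proof -
  have "finite ({..<n} \<rightarrow>\<^sub>E {..nat m})" by (intro finite_PiE) auto
  moreover have "(\<lambda>a. restrict (Poly_Mapping.lookup a) {..<n}) ` monomials n m \<subseteq> {..<n} \<rightarrow>\<^sub>E {..nat m}"
  proof (rule image_subsetI)
    fix a assume "a \<in> monomials n m"
    hence m: "int (\<Sum>i<n. Poly_Mapping.lookup a i) = m" by simp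
    have "Poly_Mapping.lookup a i \<le> nat m" if "i < n" for i
      using member_le_sum[of i "{..<n}" "Poly_Mapping.lookup a"] that unfolding m[symmetric] by (simp del: of_nat_sum)
    thus "restrict (Poly_Mapping.lookup a) {..<n} \<in> {..<n} \<rightarrow>\<^sub>E {..nat m}" by auto
  qed
  moreover have "inj_on (\<lambda>a. restrict (Poly_Mapping.lookup a) {..<n}) (monomials n m)"
  proof (rule inj_onI)
    fix a b assume ab: "a \<in> monomials n m" "b \<in> monomials n m"
      and eq: "restrict (Poly_Mapping.lookup a) {..<n} = restrict (Poly_Mapping.lookup b) {..<n}"
    show "a = b"
    proof (rule poly_mapping_eqI)
      fix i
      show "Poly_Mapping.lookup a i = Poly_Mapping.lookup b i"
      proof (cases "i < n")
        case True thus ?thesis using fun_cong[OF eq, of i] by simp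
      next
        case False
        hence "i \<notin> Poly_Mapping.keys a" "i \<notin> Poly_Mapping.keys b" using ab by auto
        thus ?thesis by (simp add: in_keys_iff)
      qed
    qed
  qed
  ultimately show ?thesis using finite_imageD finite_subset by blast
qed

lemma lookup_hsym: "Poly_Mapping.lookup (hsym n m) a = (if a \<in> monomials n m then 1 else 0)"
  unfolding hsym_def lookup_sum lookup_single when_def
  using finite_monomials[of n m] by (subst sum.delta) auto

lemma hsym_neg: "m < 0 \<Longrightarrow> hsym n m = 0"
  by (auto simp: poly_mapping_eq_iff fun_eq_iff lookup_hsym simp del: of_nat_sum)

lemma hsym_0 [simp]: "hsym n 0 = 1"
proof -
  have "monomials n 0 = {0}"
  proof (intro Set.set_eqI iffI)
    fix a assume "a \<in> monomials n 0"
    hence a: "Poly_Mapping.keys a \<subseteq> {..<n}" "\<forall>i<n. Poly_Mapping.lookup a i = 0"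
      by (auto simp del: of_nat_sum)
    have "Poly_Mapping.lookup a i = 0" for i
      using a by (cases "i < n") (auto simp: in_keys_iff)
    thus "a \<in> {0}" by (auto intro: poly_mapping_eqI)
  qed auto
  thus ?thesis by (simp add: hsym_def)
qed

lemma hsym_sym: "hsym n m \<in> sym_polys n"
  unfolding sym_polys_def
proof (safe)
  fix a i assume "a \<in> Poly_Mapping.keys (hsym n m)" "i \<in> Poly_Mapping.keys a"
  hence "Poly_Mapping.keys a \<subseteq> {..<n}" by (simp add: in_keys_iff[of a] lookup_hsym split: if_splits)
  thus "i < n" using \<open>i \<in> Poly_Mapping.keys a\<close> by blast
next
  fix \<sigma> and a :: "nat \<Rightarrow>\<^sub>0 nat" assume s: "\<sigma> permutes {..<n}"
  have inj: "inj \<sigma>" using s by (rule permutes_inj)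
  have "Poly_Mapping.keys (Poly_Mapping.map_key \<sigma> a) \<subseteq> {..<n} \<longleftrightarrow> Poly_Mapping.keys a \<subseteq> {..<n}"
  proof -
    have "Poly_Mapping.keys (Poly_Mapping.map_key \<sigma> a) = \<sigma> -` Poly_Mapping.keys a"
      by (rule keys_map_key[OF inj])
    moreover have "\<sigma> -` A \<subseteq> {..<n} \<longleftrightarrow> A \<subseteq> {..<n}" for A
    proof
      assume *: "\<sigma> -` A \<subseteq> {..<n}"
      show "A \<subseteq> {..<n}"
      proof
        fix i assume "i \<in> A"
        obtain j where j: "i = \<sigma> j" using permutes_surj[OF s] by (rule surjE)
        hence "j < n" using * \<open>i \<in> A\<close> by auto
        thus "i \<in> {..<n}" using j permutes_in_image[OF s, of j] by simp
      qed
    next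
      assume *: "A \<subseteq> {..<n}"
      show "\<sigma> -` A \<subseteq> {..<n}"
      proof
        fix j assume "j \<in> \<sigma> -` A"
        hence "\<sigma> j \<in> {..<n}" using * by auto
        thus "j \<in> {..<n}" using permutes_in_image[OF s, of j] by blast
      qed
    qed
    ultimately show ?thesis by simp
  qed
  moreover have "(\<Sum>i<n. Poly_Mapping.lookup (Poly_Mapping.map_key \<sigma> a) i) = (\<Sum>i<n. Poly_Mapping.lookup a i)"
    using sum.permute[OF s, of "Poly_Mapping.lookup a"] by (simp add: map_key.rep_eq[OF inj] comp_def)
  ultimately show "Poly_Mapping.lookup (hsym n m) (Poly_Mapping.map_key \<sigma> a) = Poly_Mapping.lookup (hsym n m) a"
    by (simp add: lookup_hsym del: of_nat_sum)
qed

text \<open>Split the monomials of degree \<open>m + 1\<close> in \<open>n + 1\<close> variables according to whether the last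
  variable occurs. As a statement on generating functions it gives \<open>hseries_eq\<close>.\<close>
lemma hsym_Suc: "hsym (Suc n) (int (Suc m)) = hsym n (int (Suc m)) + var n * hsym (Suc n) (int m)"
proof -
  let ?s = "Poly_Mapping.single n (1::nat)"
  let ?A = "monomials (Suc n) (int m)" and ?B = "monomials n (int (Suc m))"
  have sum_s: "(\<Sum>i<n. Poly_Mapping.lookup (?s + a) i) = (\<Sum>i<n. Poly_Mapping.lookup a i)" for a
    by (rule sum.cong) (auto simp: lookup_add lookup_single when_def)
  have "monomials (Suc n) (int (Suc m)) = ?B \<union> (\<lambda>a. ?s + a) ` ?A"
  proof (intro Set.set_eqI iffI)
    fix a assume a: "a \<in> monomials (Suc n) (int (Suc m))"
    show "a \<in> ?B \<union> (\<lambda>a. ?s + a) ` ?A"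
    proof (cases "Poly_Mapping.lookup a n = 0")
      case True
      have "Poly_Mapping.keys a \<subseteq> {..<n}"
      proof
        fix i assume "i \<in> Poly_Mapping.keys a"
        moreover have "i \<noteq> n" using True calculation by (auto simp: in_keys_iff)
        ultimately show "i \<in> {..<n}" using a by (auto simp: less_Suc_eq)
      qed
      thus ?thesis using a True by simp
    next
      case False
      define b where "b = a - ?s"
      have ab: "a = ?s + b"
        using False by (auto simp: b_def lookup_add lookup_minus lookup_single when_def intro!: poly_mapping_eqI)
      have "Poly_Mapping.keys b \<subseteq> {..<Suc n}"
        using a unfolding b_def by (auto simp: in_keys_iff lookup_minus subset_iff)
      moreover have "int (\<Sum>i<Suc n. Poly_Mapping.lookup b i) = int m"
      proof -
        have "(\<Sum>i<Suc n. Poly_Mapping.lookup a i) = Suc m" using a by (simp del: of_nat_sum of_nat_Suc)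
        moreover have "(\<Sum>i<n. Poly_Mapping.lookup a i) = (\<Sum>i<n. Poly_Mapping.lookup b i)"
          unfolding ab by (rule sum_s)
        moreover have "Poly_Mapping.lookup a n = Suc (Poly_Mapping.lookup b n)"
          by (simp add: ab lookup_add)
        ultimately show ?thesis by (simp del: of_nat_sum)
      qed
      ultimately show ?thesis using ab by blast
    qed
  next
    fix a assume "a \<in> ?B \<union> (\<lambda>a. ?s + a) ` ?A"
    thus "a \<in> monomials (Suc n) (int (Suc m))"
    proof
      assume a: "a \<in> ?B"
      hence "n \<notin> Poly_Mapping.keys a" by auto
      hence "Poly_Mapping.lookup a n = 0" by (simp add: in_keys_iff)
      thus ?thesis using a by (auto simp: subset_iff less_Suc_eq)
    next
      assume "a \<in> (\<lambda>a. ?s + a) ` ?A"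
      then obtain b where b: "b \<in> ?A" "a = ?s + b" by blast
      have "Poly_Mapping.keys a \<subseteq> {..<Suc n}"
        using b Poly_Mapping.keys_add[of ?s b] by (auto simp: subset_iff)
      moreover have "(\<Sum>i<Suc n. Poly_Mapping.lookup a i) = Suc m"
      proof -
        have "(\<Sum>i<Suc n. Poly_Mapping.lookup b i) = m" using b(1) by (simp del: of_nat_sum)
        moreover have "(\<Sum>i<n. Poly_Mapping.lookup a i) = (\<Sum>i<n. Poly_Mapping.lookup b i)"
          unfolding b(2) by (rule sum_s)
        moreover have "Poly_Mapping.lookup a n = Suc (Poly_Mapping.lookup b n)"
          by (simp add: b(2) lookup_add)
        ultimately show ?thesis by simp
      qed
      ultimately show ?thesis by (simp only: mem_Collect_eq)
    qed
  qed
  moreover have "?B \<inter> (\<lambda>a. ?s + a) ` ?A = {}"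
  proof (rule ccontr)
    assume "?B \<inter> (\<lambda>a. ?s + a) ` ?A \<noteq> {}"
    then obtain b where "?s + b \<in> ?B" by blast
    moreover have "n \<in> Poly_Mapping.keys (?s + b)" by (simp add: in_keys_iff lookup_add)
    ultimately show False by auto
  qed
  ultimately have "hsym (Suc n) (int (Suc m)) = hsym n (int (Suc m)) + (\<Sum>a\<in>(\<lambda>a. ?s + a) ` ?A. Poly_Mapping.single a 1)"
    unfolding hsym_def by (simp only: sum.union_disjoint finite_monomials finite_imageI)
  also have "(\<Sum>a\<in>(\<lambda>a. ?s + a) ` ?A. Poly_Mapping.single a (1::rat)) = (\<Sum>a\<in>?A. Poly_Mapping.single (?s + a) 1)"
    by (subst sum.reindex) (auto simp: inj_on_def)
  also have "\<dots> = var n * hsym (Suc n) (int m)"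
    unfolding hsym_def var_def sum_distrib_left by (simp add: mult_single)
  finally show ?thesis .
qed

lemma hsym_no_vars: "m > 0 \<Longrightarrow> hsym 0 m = 0"
  by (simp add: poly_mapping_eq_iff fun_eq_iff lookup_hsym)

definition hseries :: "nat \<Rightarrow> qpoly fps" where
  "hseries n = Abs_fps (\<lambda>m. hsym n (int m))"

text \<open>The product over \<open>A\<close> of \<open>1 - x\<^sub>i t\<close>. For all variables its coefficients are, up to sign, the
  elementary symmetric polynomials; with one variable left out it enters the bialternant formula.\<close>
definition lin_prod :: "nat set \<Rightarrow> qpoly fps" where
  "lin_prod A = (\<Prod>i\<in>A. 1 - fps_const (var i) * fps_X)"

definition geo :: "nat \<Rightarrow> qpoly fps" where
  "geo i = Abs_fps (\<lambda>m. var i ^ m)"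

lemma mult_linear_factor_nth:
  fixes c :: "'a :: comm_ring_1"
  shows "fps_nth (f * (1 - fps_const c * fps_X)) (Suc m) = fps_nth f (Suc m) - c * fps_nth f m"
    "fps_nth (f * (1 - fps_const c * fps_X)) 0 = fps_nth f 0"
proof -
  have "f * (1 - fps_const c * fps_X) = f - fps_const c * (fps_X * f)" by (simp add: algebra_simps)
  thus "fps_nth (f * (1 - fps_const c * fps_X)) (Suc m) = fps_nth f (Suc m) - c * fps_nth f m"
    "fps_nth (f * (1 - fps_const c * fps_X)) 0 = fps_nth f 0"
    by simp_all
qed

lemma geo_inverse: "geo i * (1 - fps_const (var i) * fps_X) = 1"
proof (rule fps_ext)
  fix m show "fps_nth (geo i * (1 - fps_const (var i) * fps_X)) m = fps_nth 1 m"
    by (cases m) (simp_all add: geo_def mult_linear_factor_nth)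
qed

lemma hseries_eq: "hseries n = (\<Prod>i<n. geo i)"
proof (induction n)
  case 0
  show ?case
  proof (rule fps_ext)
    fix m show "fps_nth (hseries 0) m = fps_nth (\<Prod>i<0. geo i) m"
      by (cases m) (simp_all add: hseries_def hsym_no_vars)
  qed
next
  case (Suc n)
  have "hseries (Suc n) * (1 - fps_const (var n) * fps_X) = hseries n"
  proof (rule fps_ext)
    fix m show "fps_nth (hseries (Suc n) * (1 - fps_const (var n) * fps_X)) m = fps_nth (hseries n) m"
    proof (cases m)
      case (Suc m')
      have "fps_nth (hseries (Suc n) * (1 - fps_const (var n) * fps_X)) (Suc m')
         = hsym (Suc n) (int (Suc m')) - var n * hsym (Suc n) (int m')"
        by (simp add: hseries_def mult_linear_factor_nth)
      thus ?thesis unfolding Suc hsym_Suc by (simp add: hseries_def del: of_nat_Suc)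
    qed (simp add: hseries_def mult_linear_factor_nth)
  qed
  hence "hseries (Suc n) * (geo n * (1 - fps_const (var n) * fps_X)) = hseries n * geo n"
    by (simp add: mult_ac)
  thus ?case using Suc by (simp add: geo_inverse)
qed

text \<open>The factors for \<open>A\<close> cancel against the geometric series of the complete symmetric functions.\<close>
lemma hseries_lin_prod:
  assumes "A \<subseteq> {..<n}"
  shows "hseries n * lin_prod A = (\<Prod>i\<in>{..<n} - A. geo i)"
proof -
  have "finite A" using assms finite_subset by blast
  have "hseries n = (\<Prod>i\<in>{..<n} - A. geo i) * (\<Prod>i\<in>A. geo i)"
    unfolding hseries_eq using assms by (subst prod.subset_diff[of A]) auto
  moreover have "(\<Prod>i\<in>A. geo i) * lin_prod A = 1"
    unfolding lin_prod_def prod.distrib[symmetric] by (simp add: geo_inverse)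
  ultimately show ?thesis by (simp add: mult.assoc)
qed

lemma lin_prod_insert_nth:
  assumes "finite A" "i \<notin> A"
  shows "fps_nth (lin_prod (insert i A)) (Suc m) = fps_nth (lin_prod A) (Suc m) - var i * fps_nth (lin_prod A) m"
proof -
  have "lin_prod (insert i A) = lin_prod A - fps_const (var i) * fps_X * lin_prod A"
    using assms by (simp add: lin_prod_def algebra_simps)
  thus ?thesis by (simp add: mult.assoc)
qed

lemma lin_prod_nth_0: "finite A \<Longrightarrow> fps_nth (lin_prod A) 0 = 1"
  by (induction A rule: finite_induct) (simp_all add: lin_prod_def)

lemma lin_prod_nth_big: "finite A \<Longrightarrow> card A < m \<Longrightarrow> fps_nth (lin_prod A) m = 0"
proof (induction A arbitrary: m rule: finite_induct)
  case empty
  thus ?case by (simp add: lin_prod_def)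
next
  case (insert i A)
  then obtain m' where "m = Suc m'" by (cases m) auto
  thus ?case using insert by (simp add: lin_prod_insert_nth)
qed

definition esym :: "nat \<Rightarrow> nat \<Rightarrow> qpoly" where
  "esym n m = (-1) ^ m * fps_nth (lin_prod {..<n}) m"

lemma esym_0 [simp]: "esym n 0 = 1"
  by (simp add: esym_def lin_prod_nth_0)

lemma esym_big: "n < m \<Longrightarrow> esym n m = 0"
  by (simp add: esym_def lin_prod_nth_big)

lemma esym_Suc: "esym (Suc n) (Suc m) = esym n (Suc m) + var n * esym n m"
  unfolding esym_def lessThan_Suc by (simp add: lin_prod_insert_nth algebra_simps)

lemma hsym_esym_conv:
  assumes "m > 0"
  shows "(\<Sum>i\<le>m. (-1) ^ i * hsym n (int (m - i)) * esym n i) = 0"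
proof -
  have "0 = fps_nth (hseries n * lin_prod {..<n}) m"
    using assms by (subst hseries_lin_prod) auto
  also have "\<dots> = (\<Sum>i\<le>m. fps_nth (lin_prod {..<n}) i * hsym n (int (m - i)))"
    unfolding mult.commute[of "hseries n"] fps_mult_nth by (simp add: hseries_def atLeast0AtMost)
  also have "\<dots> = (\<Sum>i\<le>m. (-1) ^ i * hsym n (int (m - i)) * esym n i)"
  proof (intro sum.cong refl)
    fix i
    have "(-1) ^ i * hsym n (int (m - i)) * esym n i
        = ((-1) ^ i * (-1) ^ i) * (fps_nth (lin_prod {..<n}) i * hsym n (int (m - i)))"
      by (simp only: esym_def mult_ac)
    also have "(-1 :: qpoly) ^ i * (-1) ^ i = 1" by (simp flip: power_mult_distrib)
    finally show "fps_nth (lin_prod {..<n}) i * hsym n (int (m - i)) = (-1) ^ i * hsym n (int (m - i)) * esym n i"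
      by (simp only: mult_1)
  qed
  finally show ?thesis by simp
qed

lemma convolution_recurrence:
  fixes a b :: "nat \<Rightarrow> 'a :: comm_ring_1"
  assumes "(\<Sum>i\<le>m. (-1) ^ i * a (m - i) * b i) = 0" "b 0 = 1" "m > 0"
  shows "a m = (\<Sum>i\<in>{1..m}. (-1) ^ (i + 1) * b i * a (m - i))"
proof -
  have "{..m} = insert 0 {1..m}" by auto
  hence "a m + (\<Sum>i\<in>{1..m}. (-1) ^ i * a (m - i) * b i) = 0"
    using assms by simp
  hence "a m = - (\<Sum>i\<in>{1..m}. (-1) ^ i * a (m - i) * b i)" by (simp add: eq_neg_iff_add_eq_0)
  thus ?thesis by (simp add: sum_negf mult_ac)
qed

lemma convolution_swap:
  fixes a b :: "nat \<Rightarrow> 'a :: comm_ring_1"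
  assumes "(\<Sum>i\<le>m. (-1) ^ i * a (m - i) * b i) = 0"
  shows "(\<Sum>i\<le>m. (-1) ^ i * b (m - i) * a i) = 0"
proof -
  have "(\<Sum>i\<le>m. (-1) ^ i * b (m - i) * a i) = (\<Sum>i\<le>m. (-1) ^ (m - i) * b i * a (m - i))"
    by (rule sum.reindex_bij_witness[of _ "\<lambda>i. m - i" "\<lambda>i. m - i"]) auto
  also have "\<dots> = (\<Sum>i\<le>m. (-1) ^ m * ((-1) ^ i * a (m - i) * b i))"
  proof (rule sum.cong[OF refl])
    fix i assume "i \<in> {..m}"
    then obtain d where "m = i + d" using le_Suc_ex[of i m] by auto
    hence "(-1 :: 'a) ^ (m - i) = (-1) ^ m * (-1) ^ i"
      by (auto simp: minus_one_power_iff)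
    thus "(-1) ^ (m - i) * b i * a (m - i) = (-1) ^ m * ((-1) ^ i * a (m - i) * b i)"
      by (simp add: mult_ac)
  qed
  also have "\<dots> = 0" using assms by (simp flip: sum_distrib_left)
  finally show ?thesis .
qed

lemma hsym_recurrence:
  "m > 0 \<Longrightarrow> hsym n (int m) = (\<Sum>i\<in>{1..m}. (-1) ^ (i + 1) * esym n i * hsym n (int (m - i)))"
  by (rule convolution_recurrence[OF hsym_esym_conv]) auto

lemma esym_recurrence:
  "m > 0 \<Longrightarrow> esym n m = (\<Sum>i\<in>{1..m}. (-1) ^ (i + 1) * hsym n (int i) * esym n (m - i))"
  by (rule convolution_recurrence[OF convolution_swap[OF hsym_esym_conv]]) auto

text \<open>Symmetry of the \<open>e\<close>s is inherited from the \<open>h\<close>s, in which they are polynomials.\<close>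
lemma esym_sym: "esym n m \<in> sym_polys n"
proof (induction m rule: less_induct)
  case (less m)
  show ?case
  proof (cases "m = 0")
    case False
    thus ?thesis
      by (subst esym_recurrence)
         (auto intro!: sym_sum sym_mult hsym_sym less sym_power sym_uminus sym_one)
  qed (simp add: sym_one)
qed

section \<open>Jacobi's bialternant formula\<close>

text \<open>The Jacobi-Trudi determinant for an arbitrary row sequence \<open>c\<close>. The index is shifted by
  \<open>n - 1 - i\<close> against a partition, so that exchanging two entries of \<open>c\<close> exchanges two rows.\<close>
definition hdet :: "nat \<Rightarrow> (nat \<Rightarrow> nat) \<Rightarrow> qpoly" where
  "hdet n c = det (mat n n (\<lambda>(i,j). hsym n (int (c i) - int (n - 1) + int j)))"

definition alternant :: "nat \<Rightarrow> (nat \<Rightarrow> nat) \<Rightarrow> qpoly" where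
  "alternant n c = det (mat n n (\<lambda>(i,l). var l ^ c i))"

lemma schur_eq_hdet: "schur n \<mu> = hdet n (\<lambda>i. \<mu> i + (n - 1 - i))"
  unfolding schur_def hdet_def
  by (rule arg_cong[of _ _ det], rule eq_matI) (auto simp: of_nat_diff)

lemma hdet_sym: "hdet n c \<in> sym_polys n"
  unfolding hdet_def by (rule sym_det) (rule hsym_sym)

lemma schur_sym: "schur n \<mu> \<in> sym_polys n"
  unfolding schur_eq_hdet by (rule hdet_sym)

text \<open>The matrix \<open>(h (c i - (n - 1) + j))\<close> times the matrix of the coefficients of \<open>lin_prod\<close> with one
  variable \<open>x\<^sub>l\<close> left out is \<open>(x\<^sub>l ^ c i)\<close>, because the generating function of the \<open>h\<close>s times that
  product is the geometric series of \<open>x\<^sub>l\<close>. The second factor does not depend on \<open>c\<close>.\<close>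
lemma hdet_alternant: "\<exists>e. \<forall>c. hdet n c * e = alternant n c"
proof -
  define P where "P l = lin_prod ({..<n} - {l})" for l
  define E where "E = mat n n (\<lambda>(j,l). fps_nth (P l) (n - 1 - j))"
  have "hdet n c * det E = alternant n c" for c
  proof -
    define A where "A = mat n n (\<lambda>(i,j). hsym n (int (c i) - int (n - 1) + int j))"
    have "A * E = mat n n (\<lambda>(i,l). var l ^ c i)"
    proof (rule eq_matI)
      fix i l assume "i < dim_row (mat n n (\<lambda>(i,l). var l ^ c i))" "l < dim_col (mat n n (\<lambda>(i,l). var l ^ c i))"
      hence il: "i < n" "l < n" by auto
      have big: "fps_nth (P l) s = 0" if "s \<ge> n" for s
        unfolding P_def using il that by (intro lin_prod_nth_big) auto
      have "(A * E) $$ (i,l) = (\<Sum>j<n. hsym n (int (c i) - int (n - 1) + int j) * fps_nth (P l) (n - 1 - j))"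
        using il by (auto simp: A_def E_def scalar_prod_def lessThan_atLeast0 intro!: sum.cong)
      also have "\<dots> = (\<Sum>s<n. hsym n (int (c i) - int s) * fps_nth (P l) s)"
        by (rule sum.reindex_bij_witness[of _ "\<lambda>j. n - 1 - j" "\<lambda>j. n - 1 - j"])
           (auto simp: of_nat_diff algebra_simps)
      also have "\<dots> = (\<Sum>s\<in>{..<n} \<union> {..c i}. hsym n (int (c i) - int s) * fps_nth (P l) s)"
        by (rule sum.mono_neutral_left) (auto simp: big)
      also have "\<dots> = (\<Sum>s\<in>{..c i}. hsym n (int (c i) - int s) * fps_nth (P l) s)"
        by (rule sum.mono_neutral_right) (auto simp: hsym_neg)
      also have "\<dots> = fps_nth (P l * hseries n) (c i)"
        unfolding fps_mult_nth
        by (auto simp: hseries_def atLeast0AtMost of_nat_diff mult.commute intro!: sum.cong)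
      also have "P l * hseries n = geo l"
        unfolding P_def by (subst mult.commute, subst hseries_lin_prod) (use il in \<open>auto simp: double_diff\<close>)
      finally show "(A * E) $$ (i,l) = mat n n (\<lambda>(i,l). var l ^ c i) $$ (i,l)"
        using il by (simp add: geo_def)
    qed (auto simp: A_def E_def)
    moreover have "det (A * E) = det A * det E"
      by (rule det_mult[of _ n]) (auto simp: A_def E_def)
    ultimately show ?thesis by (simp add: hdet_def alternant_def A_def)
  qed
  thus ?thesis by blast
qed

lemma hdet_delta: "hdet n (\<lambda>i. n - 1 - i) = 1"
proof -
  define A where "A = mat n n (\<lambda>(i,j). hsym n (int (n - 1 - i) - int (n - 1) + int j))"
  have A: "A \<in> carrier_mat n n" by (simp add: A_def)
  have "det A = prod_list (diag_mat A)"
    by (rule det_upper_triangular[OF _ A]) (auto simp: A_def of_nat_diff hsym_neg)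
  also have "diag_mat A = replicate n 1"
    by (auto simp: diag_mat_def A_def of_nat_diff intro!: nth_equalityI)
  finally show ?thesis by (simp add: hdet_def A_def)
qed

lemma alternant_eq_hdet: "alternant n c = hdet n c * alternant n (\<lambda>i. n - 1 - i)"
proof -
  obtain e where e: "\<And>c. hdet n c * e = alternant n c" using hdet_alternant[of n] by blast
  have "e = alternant n (\<lambda>i. n - 1 - i)" using e[of "\<lambda>i. n - 1 - i"] hdet_delta[of n] by simp
  thus ?thesis using e[of c] by simp
qed

lemma alternant_leibniz:
  "alternant n c = (\<Sum>p | p permutes {0..<n}. signof p * (\<Prod>i<n. var (p i) ^ c i))"
  unfolding alternant_def
  by (subst det_def'[of _ n]) (auto simp: permutes_in_image lessThan_atLeast0 intro!: sum.cong prod.cong)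

text \<open>Distinct permutations contribute distinct monomials.\<close>
lemma alternant_delta_nonzero: "alternant n (\<lambda>i. n - 1 - i) \<noteq> 0"
proof -
  define a where "a p = (\<Sum>i<n. Poly_Mapping.single (p i) (n - 1 - i))" for p :: "nat \<Rightarrow> nat"
  have la: "Poly_Mapping.lookup (a p) (p j) = n - 1 - j" if "p permutes {0..<n}" "j < n" for p j
    using that permutes_inj[OF that(1)]
    by (simp add: a_def lookup_sum lookup_single when_def inj_eq)
  have "Poly_Mapping.lookup (signof p * (\<Prod>i<n. var (p i) ^ (n - 1 - i))) (a id) = (if p = id then 1 else 0)"
    if p: "p permutes {0..<n}" for p
  proof -
    have "a p = a id \<longleftrightarrow> p = id"
    proof
      assume eq: "a p = a id"
      have "p i = i" for i
      proof (cases "i < n")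
        case True
        have "p i < n" using permutes_in_image[OF p, of i] True by auto
        hence "n - 1 - i = n - 1 - p i"
          using la[OF p True] la[OF permutes_id, of "p i"] eq by simp
        thus ?thesis using \<open>p i < n\<close> True by simp
      qed (use permutes_not_in[OF p, of i] in auto)
      thus "p = id" by (simp add: fun_eq_iff)
    qed auto
    moreover have "(\<Prod>i<n. var (p i) ^ (n - 1 - i)) = Poly_Mapping.single (a p) 1"
      by (simp add: var_power prod_single_one a_def)
    ultimately show ?thesis
      by (auto simp: sign_def lookup_single when_def)
  qed
  hence "Poly_Mapping.lookup (alternant n (\<lambda>i. n - 1 - i)) (a id) = (\<Sum>p | p permutes {0..<n}. if p = id then 1 else 0)"
    unfolding alternant_leibniz lookup_sum by (intro sum.cong) auto
  also have "\<dots> = 1"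
    by (subst sum.delta) (auto simp: finite_permutations permutes_id)
  finally show ?thesis by auto
qed

text \<open>Multiply \<open>f\<close> by the alternant \<open>a\<^sub>\<delta>\<close> of \<open>n - 1, ..., 1, 0\<close> and expand both factors: in the summand of a
  permutation, write \<open>f\<close> with its variables permuted in the same way. This gives
  \<open>f a\<^sub>\<delta> = \<Sum>\<^sub>b f\<^sub>b a\<^sub>b\<^sub>+\<^sub>\<delta>\<close>, and every alternant is \<open>a\<^sub>\<delta>\<close> times a Jacobi-Trudi determinant. The sum is over all
  exponent vectors \<open>b\<close> of \<open>f\<close>, not over partitions only; so no choice of basis is involved.\<close>
theorem sym_expansion:
  assumes f: "f \<in> sym_polys n"
  shows "f = (\<Sum>b\<in>Poly_Mapping.keys f. const (Poly_Mapping.lookup f b) * hdet n (\<lambda>i. Poly_Mapping.lookup b i + (n - 1 - i)))"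
proof -
  let ?\<delta> = "\<lambda>i. n - 1 - i"
  let ?K = "Poly_Mapping.keys f"
  have "f * alternant n ?\<delta> = (\<Sum>p | p permutes {0..<n}. signof p * (\<Prod>i<n. var (p i) ^ ?\<delta> i) * f)"
    unfolding alternant_leibniz sum_distrib_left by (simp add: mult_ac)
  also have "\<dots> = (\<Sum>p | p permutes {0..<n}. \<Sum>b\<in>?K. const (Poly_Mapping.lookup f b) *
       (signof p * (\<Prod>i<n. var (p i) ^ (Poly_Mapping.lookup b i + ?\<delta> i))))"
  proof (rule sum.cong[OF refl], safe)
    fix p assume "p permutes {0..<n}"
    hence "rename_vars p f = f" using f by (simp add: sym_polys_iff lessThan_atLeast0)
    hence "f = (\<Sum>b\<in>?K. const (Poly_Mapping.lookup f b) * (\<Prod>i<n. var (p i) ^ Poly_Mapping.lookup b i))"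
      using f by (auto simp: poly_eval_def mon_eval_superset[of "{..<n}"] sym_polys_def cong: sum.cong)
    hence "signof p * (\<Prod>i<n. var (p i) ^ ?\<delta> i) * f = signof p * (\<Prod>i<n. var (p i) ^ ?\<delta> i) *
       (\<Sum>b\<in>?K. const (Poly_Mapping.lookup f b) * (\<Prod>i<n. var (p i) ^ Poly_Mapping.lookup b i))"
      by (rule arg_cong)
    thus "signof p * (\<Prod>i<n. var (p i) ^ ?\<delta> i) * f = (\<Sum>b\<in>?K. const (Poly_Mapping.lookup f b) *
       (signof p * (\<Prod>i<n. var (p i) ^ (Poly_Mapping.lookup b i + ?\<delta> i))))"
      by (simp only: sum_distrib_left power_add prod.distrib mult_ac)
  qed
  also have "\<dots> = (\<Sum>b\<in>?K. const (Poly_Mapping.lookup f b) * alternant n (\<lambda>i. Poly_Mapping.lookup b i + ?\<delta> i))"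
    unfolding alternant_leibniz sum_distrib_left by (rule sum.swap)
  also have "\<dots> = (\<Sum>b\<in>?K. const (Poly_Mapping.lookup f b) * hdet n (\<lambda>i. Poly_Mapping.lookup b i + ?\<delta> i)) * alternant n ?\<delta>"
    unfolding sum_distrib_right by (subst alternant_eq_hdet) (simp add: mult.assoc)
  finally show ?thesis using alternant_delta_nonzero[of n] by simp
qed

section \<open>The fundamental theorem on symmetric polynomials\<close>

lemma lookup_times_sum:
  "Poly_Mapping.lookup ((p :: qpoly) * q) c = (\<Sum>a\<in>Poly_Mapping.keys p. \<Sum>b\<in>Poly_Mapping.keys q.
     if a + b = c then Poly_Mapping.lookup p a * Poly_Mapping.lookup q b else 0)"
proof -
  have "p * q = (\<Sum>a\<in>Poly_Mapping.keys p. \<Sum>b\<in>Poly_Mapping.keys q.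
     Poly_Mapping.single (a + b) (Poly_Mapping.lookup p a * Poly_Mapping.lookup q b))"
    by (subst sum_monomials, subst (3) sum_monomials) (simp only: sum_product mult_single)
  thus ?thesis by (simp add: lookup_sum lookup_single when_def)
qed

lemma lookup_const_mult: "Poly_Mapping.lookup (const c * q) a = c * Poly_Mapping.lookup q a"
  by (simp add: mult_map_scale_conv_mult[symmetric] Poly_Mapping.map.rep_eq when_def)

text \<open>The polynomial is monic with leading exponent \<open>a\<close>, for the lexicographic order of exponent
  vectors, which is the order of the type.\<close>
definition leads :: "qpoly \<Rightarrow> (nat \<Rightarrow>\<^sub>0 nat) \<Rightarrow> bool" where
  "leads p a \<longleftrightarrow> Poly_Mapping.lookup p a = 1 \<and> (\<forall>b. a < b \<longrightarrow> Poly_Mapping.lookup p b = 0)"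

lemma leads_mult:
  assumes "leads p a" "leads q b"
  shows "leads (p * q) (a + b)"
proof -
  have le: "a' \<le> a" if "a' \<in> Poly_Mapping.keys p" for a'
    using that assms(1) unfolding leads_def in_keys_iff by (meson not_less)
  have le': "b' \<le> b" if "b' \<in> Poly_Mapping.keys q" for b'
    using that assms(2) unfolding leads_def in_keys_iff by (meson not_less)
  have "Poly_Mapping.lookup (p * q) (a + b) =
    (\<Sum>a'\<in>Poly_Mapping.keys p. \<Sum>b'\<in>Poly_Mapping.keys q. if a' = a \<and> b' = b then 1 else 0)"
    unfolding lookup_times_sum
  proof (intro sum.cong refl)
    fix a' b' assume *: "a' \<in> Poly_Mapping.keys p" "b' \<in> Poly_Mapping.keys q"
    have "a' + b' = a + b \<longleftrightarrow> a' = a \<and> b' = b"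
    proof
      assume eq: "a' + b' = a + b"
      have "a' = a"
      proof (rule ccontr)
        assume "a' \<noteq> a"
        hence "a' < a" using le[OF *(1)] by simp
        hence "a' + b' < a + b" using le'[OF *(2)] by (rule add_less_le_mono)
        thus False using eq by simp
      qed
      thus "a' = a \<and> b' = b" using eq by simp
    qed simp
    thus "(if a' + b' = a + b then Poly_Mapping.lookup p a' * Poly_Mapping.lookup q b' else 0)
        = (if a' = a \<and> b' = b then 1 else 0)"
      using assms by (auto simp: leads_def)
  qed
  also have "\<dots> = (\<Sum>a'\<in>Poly_Mapping.keys p. if a' = a then \<Sum>b'\<in>Poly_Mapping.keys q. if b' = b then 1 else 0 else 0)"
    by (intro sum.cong refl) auto
  also have "\<dots> = 1"
    using assms by (simp add: leads_def in_keys_iff)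
  finally have "Poly_Mapping.lookup (p * q) (a + b) = 1" .
  moreover have "Poly_Mapping.lookup (p * q) c = 0" if "a + b < c" for c
    unfolding lookup_times_sum
  proof (intro sum.neutral ballI)
    fix a' b' assume *: "a' \<in> Poly_Mapping.keys p" "b' \<in> Poly_Mapping.keys q"
    have "a' + b' < c" using add_mono[OF le[OF *(1)] le'[OF *(2)]] that by (rule le_less_trans)
    thus "(if a' + b' = c then Poly_Mapping.lookup p a' * Poly_Mapping.lookup q b' else 0) = 0" by auto
  qed
  ultimately show ?thesis by (simp add: leads_def)
qed

lemma leads_one: "leads 1 0"
  by (auto simp: leads_def lookup_one when_def)

lemma leads_prod:
  "finite A \<Longrightarrow> (\<And>i. i \<in> A \<Longrightarrow> leads (f i) (a i)) \<Longrightarrow> leads (prod f A) (sum a A)"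
  by (induction A rule: finite_induct) (auto simp: leads_one intro: leads_mult)

lemma leads_power: "leads p a \<Longrightarrow> leads (p ^ k) (\<Sum>j<k. a)"
  using leads_prod[of "{..<k}" "\<lambda>_. p" "\<lambda>_. a"] by simp

lemma leads_add_lower: "leads p a \<Longrightarrow> leads q b \<Longrightarrow> b < a \<Longrightarrow> leads (p + q) a"
  unfolding leads_def lookup_add by (auto dest: less_trans)

lemma leads_var: "leads (var i) (Poly_Mapping.single i 1)"
  by (auto simp: leads_def var_def lookup_single when_def)

definition ones :: "nat \<Rightarrow> nat \<Rightarrow>\<^sub>0 nat" where
  "ones m = (\<Sum>i<m. Poly_Mapping.single i 1)"

lemma lookup_ones: "Poly_Mapping.lookup (ones m) i = (if i < m then 1 else 0)"
  by (auto simp: ones_def lookup_sum lookup_single when_def)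

lemma leads_esym: "m \<le> n \<Longrightarrow> leads (esym n m) (ones m)"
proof (induction n arbitrary: m)
  case 0
  thus ?case by (simp add: leads_one ones_def)
next
  case (Suc n)
  show ?case
  proof (cases m)
    case 0
    thus ?thesis by (simp add: leads_one ones_def)
  next
    case m: (Suc k)
    have k: "leads (var n * esym n k) (Poly_Mapping.single n 1 + ones k)"
      using Suc m by (intro leads_mult leads_var) auto
    show ?thesis
    proof (cases "k = n")
      case True
      thus ?thesis using k unfolding m by (simp add: esym_Suc esym_big ones_def add.commute)
    next
      case False
      hence "k < n" using Suc.prems m by simp
      hence "Poly_Mapping.single n (1::nat) < Poly_Mapping.single k 1"
        by (auto simp: less_poly_mapping.rep_eq less_fun_def lookup_single when_def intro!: exI[of _ k])
      hence "Poly_Mapping.single n 1 + ones k < ones (Suc k)"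
        by (simp add: ones_def add.commute)
      thus ?thesis using Suc.IH[of "Suc k"] k \<open>k < n\<close> unfolding m esym_Suc
        by (intro leads_add_lower) auto
    qed
  qed
qed

abbreviation esym_eval :: "nat \<Rightarrow> qpoly \<Rightarrow> qpoly" where
  "esym_eval n \<equiv> poly_eval (\<lambda>i. esym n (Suc i))"

text \<open>The leading exponent of the product of the \<open>esym n (i + 1) ^ a i\<close>.\<close>
definition tail_sums :: "nat \<Rightarrow> (nat \<Rightarrow>\<^sub>0 nat) \<Rightarrow> nat \<Rightarrow>\<^sub>0 nat" where
  "tail_sums n a = (\<Sum>i<n. \<Sum>j<Poly_Mapping.lookup a i. ones (Suc i))"

lemma lookup_tail_sums: "Poly_Mapping.lookup (tail_sums n a) j = (\<Sum>i\<in>{j..<n}. Poly_Mapping.lookup a i)"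
proof -
  have "Poly_Mapping.lookup (tail_sums n a) j = (\<Sum>i<n. if j \<le> i then Poly_Mapping.lookup a i else 0)"
    unfolding tail_sums_def lookup_sum by (intro sum.cong refl) (simp add: lookup_ones less_Suc_eq_le)
  also have "\<dots> = (\<Sum>i\<in>{..<n} \<inter> {i. j \<le> i}. Poly_Mapping.lookup a i)"
    by (simp add: sum.inter_restrict)
  also have "{..<n} \<inter> {i. j \<le> i} = {j..<n}" by auto
  finally show ?thesis .
qed

lemma tail_sums_inj:
  assumes "Poly_Mapping.keys a \<subseteq> {..<n}" "Poly_Mapping.keys b \<subseteq> {..<n}" "tail_sums n a = tail_sums n b"
  shows "a = b"
proof (rule poly_mapping_eqI)
  fix j
  show "Poly_Mapping.lookup a j = Poly_Mapping.lookup b j"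
  proof (cases "j < n")
    case True
    have "(\<Sum>i\<in>{j..<n}. Poly_Mapping.lookup a i) = (\<Sum>i\<in>{j..<n}. Poly_Mapping.lookup b i)"
      "(\<Sum>i\<in>{Suc j..<n}. Poly_Mapping.lookup a i) = (\<Sum>i\<in>{Suc j..<n}. Poly_Mapping.lookup b i)"
      using assms(3) by (simp_all flip: lookup_tail_sums)
    thus ?thesis using True by (simp add: sum.atLeast_Suc_lessThan)
  next
    case False
    hence "j \<notin> Poly_Mapping.keys a" "j \<notin> Poly_Mapping.keys b" using assms by auto
    thus ?thesis by (simp add: in_keys_iff)
  qed
qed

lemma leads_mon_eval:
  assumes "Poly_Mapping.keys a \<subseteq> {..<n}"
  shows "leads (mon_eval (\<lambda>i. esym n (Suc i)) a) (tail_sums n a)"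
  unfolding mon_eval_superset[OF finite_lessThan assms] tail_sums_def
  by (intro leads_prod leads_power leads_esym) auto

text \<open>Distinct monomials in the \<open>e\<close>s have distinct leading exponents, so the largest of these
  survives in any polynomial relation.\<close>
theorem esym_independent:
  assumes P: "P \<in> vars_below n" and 0: "esym_eval n P = 0"
  shows "P = 0"
proof (rule ccontr)
  assume "P \<noteq> 0"
  let ?L = "tail_sums n ` Poly_Mapping.keys P"
  have ne: "?L \<noteq> {}" using \<open>P \<noteq> 0\<close> by simp
  have k: "Poly_Mapping.keys a \<subseteq> {..<n}" if "a \<in> Poly_Mapping.keys P" for a
    using P that by (simp add: vars_below_def)
  obtain a where a: "a \<in> Poly_Mapping.keys P" "tail_sums n a = Max ?L"
    using Max_in[OF _ ne] by auto
  have "Poly_Mapping.lookup (esym_eval n P) (tail_sums n a)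
     = (\<Sum>b\<in>Poly_Mapping.keys P. if b = a then Poly_Mapping.lookup P a else 0)"
    unfolding poly_eval_def lookup_sum
  proof (intro sum.cong refl)
    fix b assume b: "b \<in> Poly_Mapping.keys P"
    show "Poly_Mapping.lookup (const (Poly_Mapping.lookup P b) * mon_eval (\<lambda>i. esym n (Suc i)) b) (tail_sums n a)
       = (if b = a then Poly_Mapping.lookup P a else 0)"
    proof (cases "b = a")
      case True
      thus ?thesis using leads_mon_eval[OF k[OF a(1)]] by (simp add: lookup_const_mult leads_def)
    next
      case False
      have "tail_sums n b \<le> tail_sums n a" using a(2) b by simp
      moreover have "tail_sums n b \<noteq> tail_sums n a" using tail_sums_inj[OF k[OF b] k[OF a(1)]] False by blast
      ultimately have "tail_sums n b < tail_sums n a" by simp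
      thus ?thesis using leads_mon_eval[OF k[OF b]] False by (simp add: lookup_const_mult leads_def)
    qed
  qed
  also have "\<dots> = Poly_Mapping.lookup P a" using a by simp
  finally show False using a 0 by (simp add: in_keys_iff)
qed

lemma esym_eval_inj:
  assumes "P \<in> vars_below n" "Q \<in> vars_below n" "esym_eval n P = esym_eval n Q"
  shows "P = Q"
  using esym_independent[of "P - Q" n] assms vars_below_add[of P n "- Q"]
  by (simp add: poly_eval_diff vars_below_uminus)

lemma hsym_recurrence_int:
  assumes "m > 0"
  shows "hsym n m = (\<Sum>i\<in>{1..n}. (-1) ^ (i + 1) * esym n i * hsym n (m - int i))"
proof -
  define k where "k = nat m"
  have k: "m = int k" "k > 0" using assms by (auto simp: k_def)
  have "hsym n m = (\<Sum>i\<in>{1..k}. (-1) ^ (i + 1) * esym n i * hsym n (m - int i))"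
    unfolding k hsym_recurrence[OF k(2)] by (intro sum.cong) (auto simp: of_nat_diff)
  also have "\<dots> = (\<Sum>i\<in>{1..k} \<union> {1..n}. (-1) ^ (i + 1) * esym n i * hsym n (m - int i))"
    using k by (intro sum.mono_neutral_left) (auto simp: hsym_neg)
  also have "\<dots> = (\<Sum>i\<in>{1..n}. (-1) ^ (i + 1) * esym n i * hsym n (m - int i))"
    by (intro sum.mono_neutral_right) (auto simp: esym_big)
  finally show ?thesis .
qed

text \<open>The \<open>e\<close>s generate the ring: by the recurrence they give the \<open>h\<close>s, hence the Jacobi-Trudi
  determinants, hence everything by \<open>sym_expansion\<close>.\<close>
lemma sym_induct [consumes 1, case_names const add mult esym]:
  assumes "f \<in> sym_polys n"
    and const: "\<And>c. Q (const c)"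
    and add: "\<And>p q. p \<in> sym_polys n \<Longrightarrow> q \<in> sym_polys n \<Longrightarrow> Q p \<Longrightarrow> Q q \<Longrightarrow> Q (p + q)"
    and mult: "\<And>p q. p \<in> sym_polys n \<Longrightarrow> q \<in> sym_polys n \<Longrightarrow> Q p \<Longrightarrow> Q q \<Longrightarrow> Q (p * q)"
    and esym: "\<And>m. 1 \<le> m \<Longrightarrow> m \<le> n \<Longrightarrow> Q (esym n m)"
  shows "Q f"
proof -
  define R where "R p = (p \<in> sym_polys n \<and> Q p)" for p
  have R_const: "R (const c)" for c using const by (simp add: R_def sym_const)
  have R_add: "R p \<Longrightarrow> R q \<Longrightarrow> R (p + q)" for p q using add by (auto simp: R_def sym_add)
  have R_mult: "R p \<Longrightarrow> R q \<Longrightarrow> R (p * q)" for p q using mult by (auto simp: R_def sym_mult)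
  have R_one: "R 1" and R_zero: "R 0" using R_const[of 1] R_const[of 0] by (simp_all only: single_one single_zero)
  have R_uminus: "R (- p)" if "R p" for p
    using R_mult[OF R_const[of "-1"] that] by (simp add: single_uminus)
  have R_sum: "(\<And>i. i \<in> A \<Longrightarrow> R (g i)) \<Longrightarrow> R (sum g A)" for A :: "'i set" and g
    by (induction A rule: infinite_finite_induct) (auto intro: R_add R_zero)
  have R_power: "R p \<Longrightarrow> R (p ^ k)" for p k
    by (induction k) (auto intro: R_mult R_one)
  have R_esym: "R (esym n m)" if "1 \<le> m" "m \<le> n" for m using esym that by (simp add: R_def esym_sym)
  have R_hsym_nat: "R (hsym n (int m))" for m
  proof (induction m rule: less_induct)
    case (less m)
    show ?case
    proof (cases "m = 0")
      case False
      have "R (hsym n (int m - int i))" if "1 \<le> i" for i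
        using less[of "m - i"] False that
        by (cases "i \<le> m") (auto simp: of_nat_diff hsym_neg R_zero)
      thus ?thesis using False
        by (subst hsym_recurrence_int) (auto intro!: R_sum R_mult R_power R_uminus R_one R_esym)
    qed (simp add: R_one)
  qed
  have R_hsym: "R (hsym n m)" for m
    using R_hsym_nat[of "nat m"] by (cases "m < 0") (auto simp: hsym_neg R_zero)
  have R_hdet: "R (hdet n c)" for c
    unfolding hdet_def
    by (rule det_closed_rel[of "\<lambda>x _. R x"]) (auto intro: R_one R_add R_mult R_uminus R_hsym)
  have "R (\<Sum>b\<in>Poly_Mapping.keys f. const (Poly_Mapping.lookup f b) * hdet n (\<lambda>i. Poly_Mapping.lookup b i + (n - 1 - i)))"
    by (intro R_sum R_mult R_const R_hdet)
  thus ?thesis using sym_expansion[OF assms(1)] by (simp add: R_def)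
qed

theorem esym_generates:
  assumes "f \<in> sym_polys n"
  shows "\<exists>P\<in>vars_below n. esym_eval n P = f"
  using assms
proof (induction rule: sym_induct)
  case (const c)
  show ?case by (rule bexI[of _ "const c"]) (simp_all add: vars_below_const)
next
  case (add p q)
  thus ?case by (metis poly_eval_add vars_below_add)
next
  case (mult p q)
  thus ?case by (metis poly_eval_mult vars_below_mult)
next
  case (esym m)
  thus ?case by (intro bexI[of _ "var (m - 1)"]) (auto intro: vars_below_var)
qed

text \<open>The homomorphism of rational algebras from the symmetric polynomials in \<open>n\<close> variables that
  sends \<open>esym n m\<close> to \<open>r m\<close> for \<open>1 \<le> m \<le> n\<close>. It is meaningful on symmetric polynomials, where
  the described \<open>P\<close> exists by \<open>esym_generates\<close> and is unique by \<open>esym_eval_inj\<close>.\<close>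
definition sym_hom :: "nat \<Rightarrow> (nat \<Rightarrow> qpoly) \<Rightarrow> qpoly \<Rightarrow> qpoly" where
  "sym_hom n r f = poly_eval (\<lambda>i. r (Suc i)) (THE P. P \<in> vars_below n \<and> esym_eval n P = f)"

lemma sym_hom_esym_eval:
  assumes "P \<in> vars_below n"
  shows "sym_hom n r (esym_eval n P) = poly_eval (\<lambda>i. r (Suc i)) P"
proof -
  have "(THE Q. Q \<in> vars_below n \<and> esym_eval n Q = esym_eval n P) = P"
    using assms esym_eval_inj by (intro the_equality) auto
  thus ?thesis by (simp add: sym_hom_def)
qed

lemma sym_hom_add:
  assumes "f \<in> sym_polys n" "g \<in> sym_polys n"
  shows "sym_hom n r (f + g) = sym_hom n r f + sym_hom n r g"
proof -
  obtain P Q where "P \<in> vars_below n" "Q \<in> vars_below n" "f = esym_eval n P" "g = esym_eval n Q"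
    using esym_generates assms by metis
  thus ?thesis using sym_hom_esym_eval[OF vars_below_add[of P n Q], of r] by (simp add: sym_hom_esym_eval poly_eval_add)
qed

lemma sym_hom_mult:
  assumes "f \<in> sym_polys n" "g \<in> sym_polys n"
  shows "sym_hom n r (f * g) = sym_hom n r f * sym_hom n r g"
proof -
  obtain P Q where "P \<in> vars_below n" "Q \<in> vars_below n" "f = esym_eval n P" "g = esym_eval n Q"
    using esym_generates assms by metis
  thus ?thesis using sym_hom_esym_eval[OF vars_below_mult[of P n Q], of r] by (simp add: sym_hom_esym_eval poly_eval_mult)
qed

lemma sym_hom_const [simp]: "sym_hom n r (const c) = const c"
  using sym_hom_esym_eval[OF vars_below_const[of c n], of r] by simp

lemma sym_hom_one [simp]: "sym_hom n r 1 = 1"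
  using sym_hom_const[of n r 1] by (simp only: single_one)

lemma sym_hom_zero [simp]: "sym_hom n r 0 = 0"
  using sym_hom_const[of n r 0] by simp

lemma sym_hom_uminus:
  assumes "f \<in> sym_polys n"
  shows "sym_hom n r (- f) = - sym_hom n r f"
  using sym_hom_add[OF assms sym_uminus[OF assms], of r] by (simp add: eq_neg_iff_add_eq_0 add.commute)

lemma sym_hom_diff:
  assumes "f \<in> sym_polys n" "g \<in> sym_polys n"
  shows "sym_hom n r (f - g) = sym_hom n r f - sym_hom n r g"
  using sym_hom_add[OF assms(1) sym_uminus[OF assms(2)], of r] by (simp add: sym_hom_uminus[OF assms(2)])

lemma sym_hom_sum:
  assumes "\<And>i. i \<in> A \<Longrightarrow> f i \<in> sym_polys n"
  shows "sym_hom n r (\<Sum>i\<in>A. f i) = (\<Sum>i\<in>A. sym_hom n r (f i))"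
  using assms
  by (induction A rule: infinite_finite_induct) (auto simp: sym_hom_add sym_sum)

lemma sym_hom_esym: "1 \<le> m \<Longrightarrow> m \<le> n \<Longrightarrow> sym_hom n r (esym n m) = r m"
  using sym_hom_esym_eval[OF vars_below_var[of "m - 1" n], of r] by simp

lemma sym_hom_sym:
  assumes "f \<in> sym_polys n" "\<And>m. r m \<in> sym_polys k"
  shows "sym_hom n r f \<in> sym_polys k"
  unfolding sym_hom_def by (intro sym_poly_eval assms(2))

section \<open>Ideals of symmetric polynomials\<close>

text \<open>Ideals of \<open>Lam n\<close>, with the operations of the polynomial type in place of the record fields.\<close>
definition sym_ideal :: "nat \<Rightarrow> qpoly set \<Rightarrow> bool" where
  "sym_ideal n J \<longleftrightarrow> J \<subseteq> sym_polys n \<and> 0 \<in> J \<and> (\<forall>x\<in>J. \<forall>y\<in>J. x + y \<in> J) \<and>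
     (\<forall>x\<in>J. \<forall>y\<in>sym_polys n. y * x \<in> J)"

definition sym_cong :: "nat \<Rightarrow> qpoly set \<Rightarrow> qpoly \<Rightarrow> qpoly \<Rightarrow> bool" where
  "sym_cong n J x y \<longleftrightarrow> x \<in> sym_polys n \<and> y \<in> sym_polys n \<and> x - y \<in> J"

locale sym_ideal_loc =
  fixes n :: nat and J :: "qpoly set"
  assumes J: "sym_ideal n J"
begin

lemma J_sub: "x \<in> J \<Longrightarrow> x \<in> sym_polys n"
  and J_zero: "0 \<in> J"
  and J_add: "x \<in> J \<Longrightarrow> y \<in> J \<Longrightarrow> x + y \<in> J"
  and J_mult: "x \<in> J \<Longrightarrow> y \<in> sym_polys n \<Longrightarrow> y * x \<in> J"
  using J by (auto simp: sym_ideal_def)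

lemma J_uminus: "x \<in> J \<Longrightarrow> - x \<in> J"
  using J_mult[of x "- 1"] by (simp add: sym_uminus sym_one)

abbreviation eqv (infix "\<approx>" 50) where "x \<approx> y \<equiv> sym_cong n J x y"

lemma eqv_refl: "x \<in> sym_polys n \<Longrightarrow> x \<approx> x"
  by (simp add: sym_cong_def J_zero)

lemma eqv_sym: "x \<approx> y \<Longrightarrow> y \<approx> x"
  using J_uminus[of "x - y"] by (simp add: sym_cong_def)

lemma eqv_trans [trans]: "x \<approx> y \<Longrightarrow> y \<approx> z \<Longrightarrow> x \<approx> z"
  using J_add[of "x - y" "y - z"] by (simp add: sym_cong_def)

lemma eqv_add: "x \<approx> y \<Longrightarrow> x' \<approx> y' \<Longrightarrow> x + x' \<approx> y + y'"
  using J_add[of "x - y" "x' - y'"] by (simp add: sym_cong_def sym_add algebra_simps)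

lemma eqv_uminus: "x \<approx> y \<Longrightarrow> - x \<approx> - y"
  using J_uminus[of "x - y"] by (simp add: sym_cong_def sym_uminus)

lemma eqv_mult:
  assumes "x \<approx> y" "x' \<approx> y'"
  shows "x * x' \<approx> y * y'"
proof -
  have "x * x' - y * y' = x' * (x - y) + y * (x' - y')" by (simp add: algebra_simps)
  also have "\<dots> \<in> J" using assms by (intro J_add J_mult) (auto simp: sym_cong_def)
  finally show ?thesis using assms by (simp add: sym_cong_def sym_mult)
qed

lemma eqv_sum: "(\<And>i. i \<in> A \<Longrightarrow> f i \<approx> g i) \<Longrightarrow> sum f A \<approx> sum g A"
  by (induction A rule: infinite_finite_induct) (auto intro: eqv_add eqv_refl sym_zero)

lemma eqv_det:
  "(\<And>i j. i < m \<Longrightarrow> j < m \<Longrightarrow> f i j \<approx> g i j) \<Longrightarrow>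
   det (mat m m (\<lambda>(i,j). f i j)) \<approx> det (mat m m (\<lambda>(i,j). g i j))"
  by (rule det_closed_rel[of "sym_cong n J"]) (auto intro: eqv_add eqv_mult eqv_uminus eqv_refl sym_one)

lemma eqv_zero_iff: "x \<approx> 0 \<longleftrightarrow> x \<in> J"
  using J_sub by (auto simp: sym_cong_def sym_zero)

lemma eqv_mem: "x \<approx> y \<Longrightarrow> y \<in> J \<Longrightarrow> x \<in> J"
  using eqv_trans[of x y 0] by (simp add: eqv_zero_iff)

end

lemma sgn_sym: "(-1) ^ m \<in> sym_polys n"
  by (intro sym_power sym_uminus sym_one)

section \<open>Periodicity and straightening\<close>

text \<open>The relations \<open>e\<^sub>n = 1\<close>, \<open>h\<^sub>l = 1\<close> and \<open>h\<^sub>l\<^sub>+\<^sub>1 = ... = h\<^sub>l\<^sub>+\<^sub>n\<^sub>-\<^sub>1 = 0\<close>. They turn out to present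
  the quotient by \<open>fusion_ideal_bar n l\<close>, which is the smallest such ideal for \<open>n \<ge> 2\<close>.\<close>
locale level_ideal = sym_ideal_loc +
  fixes l :: nat
  assumes n_pos: "n \<ge> 1"
    and esym_top: "esym n n - 1 \<in> J"
    and hsym_level: "hsym n (int l) - 1 \<in> J"
    and hsym_vanish: "\<And>m. l < m \<Longrightarrow> m < l + n \<Longrightarrow> hsym n (int m) \<in> J"
begin

text \<open>Modulo the relations, the sequence of the \<open>h\<close>s is periodic up to sign with period \<open>n + l\<close>.
  It satisfies a linear recurrence of order \<open>n\<close>, and the \<open>n\<close> consecutive values starting at
  \<open>l + 1\<close> are \<open>0, ..., 0, (-1) ^ (n - 1)\<close>, which is \<open>(-1) ^ (n - 1)\<close> times the values starting at
  \<open>- (n - 1)\<close>.\<close>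
lemma hsym_period:
  assumes "m > - int n"
  shows "hsym n (m + int (n + l)) \<approx> (-1) ^ (n - 1) * hsym n m"
  using assms
proof (induction "nat (m + int n)" arbitrary: m rule: less_induct)
  case (less m)
  have S: "(-1) ^ (i + 1) * esym n i * hsym n j \<in> sym_polys n" for i j
    by (intro sym_mult sgn_sym esym_sym hsym_sym)
  show ?case
  proof (cases "m < 0")
    case True
    define k where "k = nat (m + int (n + l))"
    have k: "m + int (n + l) = int k" "l < k" "k < l + n" using True less.prems by (auto simp: k_def)
    thus ?thesis using True hsym_vanish[of k] by (simp add: hsym_neg eqv_zero_iff)
  next
    case m: False
    have summand: "(-1) ^ (i + 1) * esym n i * hsym n (m + int (n + l) - int i)
        \<approx> (-1) ^ (i + 1) * esym n i * ((-1) ^ (n - 1) * hsym n (m - int i))"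
      if i: "1 \<le> i" "i \<le> n" "m > 0 \<or> i < n" for i
    proof -
      have "hsym n (m - int i + int (n + l)) \<approx> (-1) ^ (n - 1) * hsym n (m - int i)"
        by (rule less.hyps) (use i m in auto)
      moreover have "m - int i + int (n + l) = m + int (n + l) - int i" by simp
      ultimately have "hsym n (m + int (n + l) - int i) \<approx> (-1) ^ (n - 1) * hsym n (m - int i)" by (simp only:)
      thus ?thesis
        by (intro eqv_mult eqv_refl sym_mult sgn_sym esym_sym)
    qed
    have rec: "hsym n (m + int (n + l)) = (\<Sum>i\<in>{1..n}. (-1) ^ (i + 1) * esym n i * hsym n (m + int (n + l) - int i))"
      by (rule hsym_recurrence_int) (use m n_pos in linarith)
    show ?thesis
    proof (cases "m = 0")
      case True
      have "(\<Sum>i\<in>{1..n}. (-1) ^ (i + 1) * esym n i * hsym n (m + int (n + l) - int i))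
          \<approx> (\<Sum>i\<in>{1..n}. if i = n then (-1) ^ (n + 1) else 0)"
      proof (rule eqv_sum)
        fix i assume i: "i \<in> {1..n}"
        show "(-1) ^ (i + 1) * esym n i * hsym n (m + int (n + l) - int i) \<approx> (if i = n then (-1) ^ (n + 1) else 0)"
        proof (cases "i = n")
          case False
          thus ?thesis using summand[of i] i True by (simp add: hsym_neg)
        next
          case i: True
          have "(-1) ^ (n + 1) * esym n n * hsym n (int l) \<approx> (-1) ^ (n + 1) * 1 * 1"
            using esym_top hsym_level
            by (intro eqv_mult eqv_refl sgn_sym) (auto simp: sym_cong_def esym_sym hsym_sym sym_one)
          thus ?thesis using True i by simp
        qed
      qed
      also have "(\<Sum>i\<in>{1..n}. if i = n then (-1) ^ (n + 1) else 0) = (-1 :: qpoly) ^ (n + 1)"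
        using n_pos by simp
      also have "(-1 :: qpoly) ^ (n + 1) = (-1) ^ (n - 1)"
        using n_pos by (cases n) auto
      finally show ?thesis using True rec by simp
    next
      case False
      hence "m > 0" using m by simp
      have "(\<Sum>i\<in>{1..n}. (-1) ^ (i + 1) * esym n i * hsym n (m + int (n + l) - int i))
         \<approx> (\<Sum>i\<in>{1..n}. (-1) ^ (i + 1) * esym n i * ((-1) ^ (n - 1) * hsym n (m - int i)))"
        using \<open>m > 0\<close> by (intro eqv_sum summand) auto
      also have "\<dots> = (-1) ^ (n - 1) * hsym n m"
        unfolding hsym_recurrence_int[OF \<open>m > 0\<close>] sum_distrib_left by (intro sum.cong refl) (simp only: mult_ac)
      finally show ?thesis unfolding rec .
    qed
  qed
qed

lemma hdet_period:
  assumes i: "i < n"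
  shows "hdet n (c(i := c i + (n + l))) \<approx> (-1) ^ (n - 1) * hdet n c"
proof -
  define A where "A = mat n n (\<lambda>(i,j). hsym n (int (c i) - int (n - 1) + int j))"
  have "hdet n (c(i := c i + (n + l))) \<approx>
      det (mat n n (\<lambda>(a,b). if a = i then (-1) ^ (n - 1) * hsym n (int (c a) - int (n - 1) + int b)
                             else hsym n (int (c a) - int (n - 1) + int b)))"
    unfolding hdet_def
  proof (rule eqv_det)
    fix a b assume ab: "a < n" "b < n"
    show "hsym n (int ((c(i := c i + (n + l))) a) - int (n - 1) + int b) \<approx>
      (if a = i then (-1) ^ (n - 1) * hsym n (int (c a) - int (n - 1) + int b)
                             else hsym n (int (c a) - int (n - 1) + int b))"
    proof (cases "a = i")
      case True
      have "int (c i + (n + l)) - int (n - 1) + int b = (int (c i) - int (n - 1) + int b) + int (n + l)" by simp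
      moreover have "hsym n ((int (c i) - int (n - 1) + int b) + int (n + l)) \<approx>
          (-1) ^ (n - 1) * hsym n (int (c i) - int (n - 1) + int b)"
        by (rule hsym_period) (use n_pos in linarith)
      ultimately show ?thesis unfolding True by (simp only: fun_upd_same if_True refl)
    qed (simp add: eqv_refl hsym_sym)
  qed
  also have "mat n n (\<lambda>(a,b). if a = i then (-1) ^ (n - 1) * hsym n (int (c a) - int (n - 1) + int b)
                             else hsym n (int (c a) - int (n - 1) + int b)) = multrow i ((-1) ^ (n - 1)) A"
    by (rule eq_matI) (auto simp: A_def)
  also have "det (multrow i ((-1) ^ (n - 1)) A) = (-1) ^ (n - 1) * det A"
    by (rule det_multrow[OF i]) (simp add: A_def)
  finally show ?thesis by (simp add: A_def hdet_def)
qed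

end

lemma hdet_equal_entries:
  assumes "i < n" "j < n" "i \<noteq> j" "c i = c j"
  shows "hdet n c = 0"
  unfolding hdet_def
  by (rule det_identical_rows[OF _ assms(3,1,2)]) (use assms in \<open>auto simp: row_def\<close>)

lemma hdet_swap:
  assumes "i < n" "j < n" "i \<noteq> j"
  shows "hdet n (c(i := c j, j := c i)) = - hdet n c"
proof -
  define A where "A = mat n n (\<lambda>(i,j). hsym n (int (c i) - int (n - 1) + int j))"
  have "mat n n (\<lambda>(a,b). hsym n (int ((c(i := c j, j := c i)) a) - int (n - 1) + int b)) = swaprows i j A"
    using assms by (intro eq_matI) (auto simp: A_def)
  moreover have "det (swaprows i j A) = - det A"
    by (rule det_swaprows[OF assms]) (simp add: A_def)
  ultimately show ?thesis by (simp add: hdet_def A_def)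
qed

lemma hdet_cong: "(\<And>i. i < n \<Longrightarrow> c i = d i) \<Longrightarrow> hdet n c = hdet n d"
  unfolding hdet_def by (intro arg_cong[of _ _ det] eq_matI) auto

context level_ideal
begin

text \<open>If \<open>\<mu> 0 - \<mu> (n - 1) = l + 1\<close>, then the first and the last row of the Jacobi-Trudi matrix
  differ by exactly one period, so they are proportional modulo the ideal.\<close>
lemma schur_generator_mem:
  assumes "n \<ge> 2" "int (\<mu> 0) - int (\<mu> (n - 1)) = int l + 1"
  shows "schur n \<mu> \<in> J"
proof -
  define c where "c = (\<lambda>i. \<mu> i + (n - 1 - i))(0 := \<mu> (n - 1))"
  have "schur n \<mu> = hdet n (c(0 := c 0 + (n + l)))"
    unfolding schur_eq_hdet by (rule hdet_cong) (use assms in \<open>auto simp: c_def\<close>)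
  also have "\<dots> \<approx> (-1) ^ (n - 1) * hdet n c"
    by (rule hdet_period) (use n_pos in simp)
  also have "hdet n c = 0"
    by (rule hdet_equal_entries[of 0 n "n - 1"]) (use assms in \<open>auto simp: c_def\<close>)
  finally show ?thesis by (simp add: eqv_zero_iff)
qed

text \<open>Rows may be shifted by the period and exchanged, each time at the cost of a sign. Reducing all
  entries below \<open>n + l\<close> and sorting them leaves either two equal rows or a strictly decreasing
  sequence, and the latter is a partition with at most \<open>n\<close> parts, none larger than \<open>l\<close>.\<close>
lemma hdet_straighten:
  "hdet n c \<in> J \<or> (\<exists>\<mu> s. partition_le n \<mu> \<and> \<mu> 0 \<le> l \<and> hdet n c \<approx> const s * schur n \<mu>)"
  (is "?P c")
\<comment> \<open>The weights \<open>i + 1\<close> make the measure drop also when an ascent is sorted.\<close>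
proof (induction "\<Sum>i<n. c i * (i + 1)" arbitrary: c rule: less_induct)
  case (less c)
  have scale: "?P c" if "hdet n c \<approx> const s * hdet n d" "?P d" for s d
    using that(2)
  proof
    assume "hdet n d \<in> J"
    hence "const s * hdet n d \<in> J" by (intro J_mult sym_const)
    thus ?thesis using eqv_mem[OF that(1)] by simp
  next
    assume "\<exists>\<mu> s. partition_le n \<mu> \<and> \<mu> 0 \<le> l \<and> hdet n d \<approx> const s * schur n \<mu>"
    then obtain \<mu> t where \<mu>: "partition_le n \<mu>" "\<mu> 0 \<le> l" "hdet n d \<approx> const t * schur n \<mu>" by blast
    have "hdet n c \<approx> const s * (const t * schur n \<mu>)"
      using that(1) eqv_mult[OF eqv_refl[OF sym_const] \<mu>(3)] by (rule eqv_trans)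
    hence "hdet n c \<approx> const (s * t) * schur n \<mu>"
      by (simp add: mult.assoc[symmetric] mult_single)
    thus ?thesis using \<mu>(1,2) by blast
  qed
  have neg1: "(-1 :: qpoly) ^ m = const ((-1) ^ m)" for m
    by (induction m) (simp_all add: single_uminus)
  consider (big) i where "i < n" "c i \<ge> n + l"
    | (eq) i where "Suc i < n" "c i = c (Suc i)"
    | (swap) i where "Suc i < n" "c i < c (Suc i)"
    | (sorted) "\<And>i. i < n \<Longrightarrow> c i < n + l" "\<And>i. Suc i < n \<Longrightarrow> c (Suc i) < c i"
    by (meson linorder_neqE_nat not_less)
  thus ?case
  proof cases
    case big
    define d where "d = c(i := c i - (n + l))"
    have "c = d(i := d i + (n + l))" using big by (auto simp: d_def)
    hence "hdet n c \<approx> const ((-1) ^ (n - 1)) * hdet n d"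
      using hdet_period[OF big(1), of d] by (simp add: neg1)
    moreover have "(\<Sum>i<n. d i * (i + 1)) < (\<Sum>i<n. c i * (i + 1))"
    proof (rule sum_strict_mono_ex1)
      show "\<forall>j\<in>{..<n}. d j * (j + 1) \<le> c j * (j + 1)" by (auto simp: d_def simp del: mult_Suc_right)
      have "d i < c i" using big n_pos by (simp add: d_def)
      hence "d i * (i + 1) < c i * (i + 1)" by (intro mult_less_mono1) auto
      thus "\<exists>j\<in>{..<n}. d j * (j + 1) < c j * (j + 1)" using big by blast
    qed simp
    ultimately show ?thesis using less.hyps[of d] scale by blast
  next
    case eq
    hence "hdet n c = 0" by (intro hdet_equal_entries[of i n "Suc i"]) auto
    thus ?thesis using J_zero by simp
  next
    case swap
    define d where "d = c(i := c (Suc i), Suc i := c i)"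
    have "hdet n d = - hdet n c" unfolding d_def using swap by (intro hdet_swap) auto
    hence "hdet n c \<approx> const (-1) * hdet n d"
      by (simp add: single_uminus eqv_refl hdet_sym)
    moreover have "(\<Sum>i<n. d i * (i + 1)) < (\<Sum>i<n. c i * (i + 1))"
    proof -
      have split: "(\<Sum>j<n. f j) = f i + (f (Suc i) + (\<Sum>j\<in>{..<n} - {i} - {Suc i}. f j))" for f :: "nat \<Rightarrow> nat"
        using swap by (subst sum.remove[of _ i], simp, simp, subst sum.remove[of _ "Suc i"]) auto
      have rest: "(\<Sum>j\<in>{..<n} - {i} - {Suc i}. d j * (j + 1)) = (\<Sum>j\<in>{..<n} - {i} - {Suc i}. c j * (j + 1))"
        by (rule sum.cong) (auto simp: d_def)
      obtain t where t: "c (Suc i) = Suc (c i + t)" using less_imp_Suc_add[OF swap(2)] by blast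
      have "d i * (i + 1) + d (Suc i) * (Suc i + 1) < c i * (i + 1) + c (Suc i) * (Suc i + 1)"
        by (simp add: d_def t algebra_simps)
      thus ?thesis unfolding split[of "\<lambda>j. d j * (j + 1)"] split[of "\<lambda>j. c j * (j + 1)"] rest by linarith
    qed
    ultimately show ?thesis using less.hyps[of d] scale by blast
  next
    case sorted
    have low: "k < n \<Longrightarrow> k \<le> c (n - 1 - k)" for k
    proof (induction k)
      case (Suc k)
      have "Suc (n - 1 - Suc k) = n - 1 - k" using Suc.prems by simp
      hence "c (n - 1 - k) < c (n - 1 - Suc k)" using sorted(2)[of "n - 1 - Suc k"] Suc.prems by simp
      thus ?case using Suc by simp
    qed simp
    have low': "n - 1 - i \<le> c i" if "i < n" for i
      using low[of "n - 1 - i"] that by simp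
    define \<mu> where "\<mu> i = (if i < n then c i - (n - 1 - i) else 0)" for i
    have "antimono \<mu>"
    proof (rule antimonoI, rule lift_Suc_antimono_le[of \<mu>])
      fix i
      show "\<mu> (Suc i) \<le> \<mu> i"
      proof (cases "Suc i < n")
        case True
        thus ?thesis using sorted(2)[OF True] by (simp add: \<mu>_def)
      qed (simp add: \<mu>_def)
    qed
    hence "partition_le n \<mu>" by (simp add: partition_le_def \<mu>_def)
    moreover have "\<mu> 0 \<le> l" using sorted(1)[of 0] n_pos by (simp add: \<mu>_def)
    moreover have "hdet n c = schur n \<mu>"
      unfolding schur_eq_hdet by (rule hdet_cong) (use low' in \<open>simp only: \<mu>_def if_True le_add_diff_inverse2\<close>)
    hence "hdet n c \<approx> const 1 * schur n \<mu>" by (simp add: eqv_refl schur_sym)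
    ultimately show ?thesis by blast
  qed
qed

lemma box_schur_span:
  assumes "f \<in> sym_polys n"
    and mem: "\<And>x. x \<in> J \<Longrightarrow> Q x"
    and add: "\<And>x y. x \<in> sym_polys n \<Longrightarrow> y \<in> sym_polys n \<Longrightarrow> Q x \<Longrightarrow> Q y \<Longrightarrow> Q (x + y)"
    and scale: "\<And>c x. x \<in> sym_polys n \<Longrightarrow> Q x \<Longrightarrow> Q (const c * x)"
    and schur: "\<And>\<mu>. partition_le n \<mu> \<Longrightarrow> \<mu> 0 \<le> l \<Longrightarrow> Q (schur n \<mu>)"
  shows "Q f"
proof -
  have "Q (hdet n c)" for c
    using hdet_straighten[of c]
  proof
    assume "\<exists>\<mu> s. partition_le n \<mu> \<and> \<mu> 0 \<le> l \<and> hdet n c \<approx> const s * schur n \<mu>"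
    then obtain \<mu> s where \<mu>: "partition_le n \<mu>" "\<mu> 0 \<le> l" "hdet n c \<approx> const s * schur n \<mu>" by blast
    have "Q (const s * schur n \<mu> + (hdet n c - const s * schur n \<mu>))"
      by (intro add scale schur \<mu> mem schur_sym sym_mult sym_const sym_diff hdet_sym)
         (use \<mu>(3) in \<open>simp add: sym_cong_def\<close>)
    thus ?thesis by simp
  qed (rule mem)
  hence Q: "Q (const a * hdet n c)" for a c by (intro scale hdet_sym)
  have S: "const a * hdet n c \<in> sym_polys n" for a c by (intro sym_mult sym_const hdet_sym)
  have all: "Q (\<Sum>b\<in>A. const (Poly_Mapping.lookup f b) * hdet n (\<lambda>i. Poly_Mapping.lookup b i + (n - 1 - i)))" for A
  proof (induction A rule: infinite_finite_induct)
    case (insert b A)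
    show ?case unfolding sum.insert[OF insert.hyps] by (intro add Q S sym_sum insert.IH)
  qed (simp_all add: mem J_zero)
  show ?thesis by (subst sym_expansion[OF assms(1)]) (rule all)
qed

end

section \<open>The fusion ideals\<close>

lemma Lam_simps [simp]:
  "carrier (Lam n) = sym_polys n" "x \<otimes>\<^bsub>Lam n\<^esub> y = x * y" "\<one>\<^bsub>Lam n\<^esub> = 1"
  "\<zero>\<^bsub>Lam n\<^esub> = 0" "x \<oplus>\<^bsub>Lam n\<^esub> y = x + y" "c \<odot>\<^bsub>Lam n\<^esub> x = const c * x"
  by (simp_all add: Lam_def)

lemma cring_Lam: "cring (Lam n)"
proof (rule cringI)
  show "abelian_group (Lam n)"
  proof (rule abelian_groupI)
    fix x assume "x \<in> carrier (Lam n)"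
    thus "\<exists>y\<in>carrier (Lam n). y \<oplus>\<^bsub>Lam n\<^esub> x = \<zero>\<^bsub>Lam n\<^esub>"
      by (intro bexI[of _ "- x"]) (auto simp: sym_uminus)
  qed (auto simp: sym_add sym_zero add_ac)
  show "comm_monoid (Lam n)"
    by (rule comm_monoidI) (auto simp: sym_mult sym_one mult_ac)
qed (auto simp: distrib_right)

lemma ring_Lam: "ring (Lam n)"
  using cring_Lam by (rule cring.axioms)

lemma Lam_a_inv: "x \<in> sym_polys n \<Longrightarrow> \<ominus>\<^bsub>Lam n\<^esub> x = - x"
  using abelian_group.minus_equality[OF ring.is_abelian_group[OF ring_Lam], of n "- x" x]
  by (simp add: sym_uminus)

lemma Lam_a_minus: "x \<in> sym_polys n \<Longrightarrow> y \<in> sym_polys n \<Longrightarrow> x \<ominus>\<^bsub>Lam n\<^esub> y = x - y"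
  by (simp add: a_minus_def Lam_a_inv)

lemma ideal_Lam_iff: "ideal J (Lam n) \<longleftrightarrow> sym_ideal n J"
proof
  assume "ideal J (Lam n)"
  then interpret ideal J "Lam n" .
  show "sym_ideal n J"
    using a_subset additive_subgroup.zero_closed[OF is_additive_subgroup]
      additive_subgroup.a_closed[OF is_additive_subgroup] I_l_closed
    by (auto simp: sym_ideal_def)
next
  assume J: "sym_ideal n J"
  then interpret sym_ideal_loc n J by unfold_locales
  have J_mult': "x * y \<in> J" if "x \<in> J" "y \<in> sym_polys n" for x y
    using J_mult[OF that] by (simp add: mult.commute)
  show "ideal J (Lam n)"
  proof (rule idealI[OF ring_Lam])
    show "subgroup J (add_monoid (Lam n))"
    proof (rule subgroup.intro)
      fix x assume "x \<in> J"
      thus "inv\<^bsub>add_monoid (Lam n)\<^esub> x \<in> J"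
        using J_uminus Lam_a_inv[OF J_sub] by (simp add: a_inv_def)
    qed (auto intro: J_sub J_zero J_add)
  qed (auto intro: J_mult J_mult')
qed

lemma sym_ideal_fusion_ideal: "sym_ideal n (fusion_ideal n l)"
  unfolding fusion_ideal_def ideal_Lam_iff[symmetric]
  by (rule ring.genideal_ideal[OF ring_Lam]) (auto simp: schur_sym sym_diff sym_one)

lemma fusion_ideal_sub: "fusion_ideal n l \<subseteq> sym_polys n"
  using sym_ideal_fusion_ideal[of n l] by (simp add: sym_ideal_def)

lemma fusion_ideal_bar_gens_sub: "fusion_ideal n l \<union> {hsym n (int l) - 1} \<subseteq> carrier (Lam n)"
  using fusion_ideal_sub by (auto simp: hsym_sym sym_diff sym_one)

lemma sym_ideal_fusion_ideal_bar: "sym_ideal n (fusion_ideal_bar n l)"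
  unfolding fusion_ideal_bar_def ideal_Lam_iff[symmetric]
  by (rule ring.genideal_ideal[OF ring_Lam fusion_ideal_bar_gens_sub])

lemma fusion_ideal_bar_contains:
  "x \<in> fusion_ideal n l \<Longrightarrow> x \<in> fusion_ideal_bar n l" "hsym n (int l) - 1 \<in> fusion_ideal_bar n l"
  using ring.genideal_self[OF ring_Lam fusion_ideal_bar_gens_sub] unfolding fusion_ideal_bar_def by auto

lemma fusion_ideal_contains:
  "schur n (col_part n) - 1 \<in> fusion_ideal n l"
  "partition_le n \<mu> \<Longrightarrow> int (\<mu> 0) - int (\<mu> (n - 1)) = int l + 1 \<Longrightarrow> schur n \<mu> \<in> fusion_ideal n l"
proof -
  have "{schur n (col_part n) - 1} \<union>
      {schur n \<mu> | \<mu>. partition_le n \<mu> \<and> int (\<mu> 0) - int (\<mu> (n - 1)) = int l + 1} \<subseteq> fusion_ideal n l"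
    unfolding fusion_ideal_def
    by (rule ring.genideal_self[OF ring_Lam]) (auto simp: schur_sym sym_diff sym_one)
  thus "schur n (col_part n) - 1 \<in> fusion_ideal n l"
    "partition_le n \<mu> \<Longrightarrow> int (\<mu> 0) - int (\<mu> (n - 1)) = int l + 1 \<Longrightarrow> schur n \<mu> \<in> fusion_ideal n l"
    by auto
qed

lemma fusion_ideal_bar_minimal:
  assumes "sym_ideal n Q" "fusion_ideal n l \<subseteq> Q" "hsym n (int l) - 1 \<in> Q"
  shows "fusion_ideal_bar n l \<subseteq> Q"
  unfolding fusion_ideal_bar_def
  by (rule ring.genideal_minimal[OF ring_Lam]) (use assms in \<open>auto simp: ideal_Lam_iff\<close>)

definition esym_int :: "nat \<Rightarrow> int \<Rightarrow> qpoly" where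
  "esym_int n m = (if m < 0 then 0 else esym n (nat m))"

lemma schur_dual:
  assumes "partition_le n \<mu>" "\<mu> 0 \<le> k"
  shows "schur n \<mu> = det (mat k k (\<lambda>(i,j). esym_int n (int (conj_part \<mu> i) - int i + int j)))"
  unfolding schur_def
proof (rule dual_jacobi_trudi[OF _ _ _ _ _ assms])
  fix m :: nat assume "m > 0"
  thus "(\<Sum>i\<le>m. (-1) ^ i * hsym n (int (m - i)) * esym_int n (int i)) = 0"
    using hsym_esym_conv[of m n] by (simp add: esym_int_def)
qed (auto simp: hsym_neg esym_int_def)

text \<open>Since the relation between the \<open>e\<close>s and the \<open>h\<close>s is symmetric, the dual Jacobi-Trudi identity
  may be read with the two sequences exchanged.\<close>
lemma schur_conj_dual:
  assumes "partition_le N \<mu>" "\<mu> 0 \<le> k"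
  shows "schur k (conj_part \<mu>) = det (mat N N (\<lambda>(i,j). esym_int k (int (\<mu> i) - int i + int j)))"
  unfolding schur_def
proof (rule dual_jacobi_trudi[symmetric, OF _ _ _ _ _ assms])
  fix m :: nat assume "m > 0"
  have "(\<Sum>i\<le>m. (-1) ^ i * esym k (m - i) * hsym k (int i)) = 0"
    by (rule convolution_swap[where a = "\<lambda>i. hsym k (int i)", OF hsym_esym_conv[OF \<open>m > 0\<close>]])
  moreover have "esym_int k (int i) = esym k i" for i by (simp add: esym_int_def)
  ultimately show "(\<Sum>i\<le>m. (-1) ^ i * esym_int k (int (m - i)) * hsym k (int i)) = 0"
    by (simp only:)
qed (auto simp: hsym_neg esym_int_def)

lemma schur_col_part: "schur n (col_part n) = esym n n"
proof -
  have "partition_le n (col_part n)" "col_part n 0 \<le> 1"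
    by (auto simp: partition_le_def antimono_def col_part_def)
  hence "schur n (col_part n) = det (mat 1 1 (\<lambda>(i,j). esym_int n (int (conj_part (col_part n) i) - int i + int j)))"
    by (rule schur_dual)
  also have "\<dots> = esym_int n (int (conj_part (col_part n) 0))"
    by (subst det_single) auto
  also have "{i. 0 < col_part n i} = {..<n}" by (auto simp: col_part_def split: if_splits)
  hence "conj_part (col_part n) 0 = n" by (simp add: conj_part_def)
  finally show ?thesis by (simp add: esym_int_def)
qed

text \<open>Take the hook with first row \<open>l + 1\<close> and \<open>j\<close> further boxes in the first column. Moving the first
  row of its Jacobi-Trudi matrix below the next \<open>j\<close> rows gives a matrix that is upper triangular
  modulo the \<open>h\<close>s treated before, with diagonal entries \<open>1\<close> except for \<open>hsym n (l + 1 + j)\<close>.\<close>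
lemma hsym_mem_fusion_ideal:
  assumes "j + 1 < n"
  shows "hsym n (int (l + 1 + j)) \<in> fusion_ideal n l"
  using assms
proof (induction j rule: less_induct)
  case (less j)
  interpret sym_ideal_loc n "fusion_ideal n l"
    by unfold_locales (rule sym_ideal_fusion_ideal)
  define \<mu> where "\<mu> i = (if i = 0 then l + 1 else if i \<le> j then 1 else 0)" for i :: nat
  have "partition_le n \<mu>" "int (\<mu> 0) - int (\<mu> (n - 1)) = int l + 1"
    using less.prems by (auto simp: \<mu>_def partition_le_def antimono_def)
  hence mem: "schur n \<mu> \<in> fusion_ideal n l" by (rule fusion_ideal_contains)
  define c where "c i = \<mu> i + (n - 1 - i)" for i
  define p where "p i = (if i < j then i + 1 else if i = j then 0 else i)" for i
  have p: "p permutes {0..<n}"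
  proof (rule bij_imp_permutes)
    show "bij_betw p {0..<n} {0..<n}"
      by (rule bij_betw_byWitness[where f' = "\<lambda>i. if i = 0 then j else if i \<le> j then i - 1 else i"])
         (use less.prems in \<open>auto simp: p_def\<close>)
  qed (use less.prems in \<open>auto simp: p_def\<close>)
  define A where "A = mat n n (\<lambda>(i,j). hsym n (int (c i) - int (n - 1) + int j))"
  have "det (mat n n (\<lambda>(i,j). A $$ (p i, j))) = signof p * det A"
    by (rule det_permute_rows[OF _ p]) (simp add: A_def)
  also have "mat n n (\<lambda>(i,j). A $$ (p i, j)) = mat n n (\<lambda>(i,j). hsym n (int (c (p i)) - int (n - 1) + int j))"
    using permutes_in_image[OF p] by (intro eq_matI) (auto simp: A_def)
  also have "det A = schur n \<mu>" by (simp add: schur_eq_hdet hdet_def A_def c_def)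
  finally have permuted: "det (mat n n (\<lambda>(i,j). hsym n (int (c (p i)) - int (n - 1) + int j))) = signof p * schur n \<mu>" .
  define T where "T = mat n n (\<lambda>(i,b). if b < i then 0 else hsym n (int (c (p i)) - int (n - 1) + int b))"
  have row: "hsym n (int (c (p i)) - int (n - 1) + int b) =
      (if i = j then hsym n (int (l + 1 + b)) else hsym n (int b - int i))" if "i < n" for i b
  proof -
    have "int (c (p i)) - int (n - 1) = (if i = j then int (l + 1) else - int i)"
      using that less.prems by (auto simp: c_def p_def \<mu>_def of_nat_diff)
    thus ?thesis by (auto simp: algebra_simps)
  qed
  let ?eqv = "sym_cong n (fusion_ideal n l)"
  have "?eqv (det (mat n n (\<lambda>(i,b). if b < i then 0 else hsym n (int (c (p i)) - int (n - 1) + int b))))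
     (det (mat n n (\<lambda>(i,j). hsym n (int (c (p i)) - int (n - 1) + int j))))"
  proof (rule eqv_det)
    fix i b assume ib: "i < n" "b < n"
    have "?eqv 0 (hsym n (int (c (p i)) - int (n - 1) + int b))" if "b < i"
    proof (cases "i = j")
      case True
      hence "hsym n (int (l + 1 + b)) \<in> fusion_ideal n l" using less that by auto
      hence "?eqv 0 (hsym n (int (l + 1 + b)))" using eqv_sym eqv_zero_iff by blast
      thus ?thesis unfolding row[OF ib(1)] using True by (simp only: if_True refl)
    next
      case False
      thus ?thesis unfolding row[OF ib(1)] using that by (simp add: hsym_neg eqv_refl sym_zero)
    qed
    thus "?eqv (if b < i then 0 else hsym n (int (c (p i)) - int (n - 1) + int b))
        (hsym n (int (c (p i)) - int (n - 1) + int b))"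
      by (simp add: eqv_refl hsym_sym)
  qed
  moreover have "signof p * schur n \<mu> \<in> fusion_ideal n l"
    using J_mult[OF mem, of "signof p"] by (auto simp: sign_def sym_one sym_uminus)
  ultimately have "det T \<in> fusion_ideal n l"
    unfolding T_def permuted by (rule eqv_mem)
  moreover have "det T = hsym n (int (l + 1 + j))"
  proof -
    have T: "T \<in> carrier_mat n n" by (simp add: T_def)
    have "det T = prod_list (diag_mat T)"
      by (rule det_upper_triangular[OF _ T]) (auto simp: T_def)
    also have "\<dots> = (\<Prod>i<n. T $$ (i,i))"
      using T by (simp add: diag_mat_def prod.list_conv_set_nth lessThan_atLeast0)
    also have "\<dots> = (\<Prod>i<n. if i = j then hsym n (int (l + 1 + j)) else 1)"
    proof (rule prod.cong[OF refl])
      fix i assume "i \<in> {..<n}"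
      hence "i < n" by simp
      have "T $$ (i,i) = (if i = j then hsym n (int (l + 1 + i)) else hsym n (int i - int i))"
        unfolding row[OF \<open>i < n\<close>, symmetric] using \<open>i < n\<close> by (simp add: T_def)
      thus "T $$ (i,i) = (if i = j then hsym n (int (l + 1 + j)) else 1)"
        by (simp del: of_nat_add of_nat_Suc)
    qed
    also have "\<dots> = hsym n (int (l + 1 + j))" using less.prems by simp
    finally show ?thesis .
  qed
  ultimately show ?case by simp
qed

lemma level_ideal_fusion_ideal_bar:
  assumes "n \<ge> 1"
  shows "level_ideal n (fusion_ideal_bar n l) l"
proof (unfold_locales)
  show "esym n n - 1 \<in> fusion_ideal_bar n l"
    using fusion_ideal_contains(1)[of n l] by (simp add: schur_col_part fusion_ideal_bar_contains(1))
  fix m assume "l < m" "m < l + n"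
  thus "hsym n (int m) \<in> fusion_ideal_bar n l"
    using hsym_mem_fusion_ideal[of "m - l - 1" n l] by (intro fusion_ideal_bar_contains(1)) (simp add: of_nat_diff)
qed (use assms sym_ideal_fusion_ideal_bar fusion_ideal_bar_contains in auto)

text \<open>Together with the preceding lemma, this identifies the ideal by the relations of
  \<open>level_ideal\<close> alone.\<close>
lemma fusion_ideal_bar_le:
  assumes "level_ideal n Q l" "n \<ge> 2"
  shows "fusion_ideal_bar n l \<subseteq> Q"
proof -
  interpret level_ideal n Q l by fact
  have "fusion_ideal n l \<subseteq> Q"
    unfolding fusion_ideal_def
  proof (rule ring.genideal_minimal[OF ring_Lam])
    show "ideal Q (Lam n)" by (simp add: ideal_Lam_iff J)
  qed (use esym_top schur_generator_mem[OF assms(2)] in \<open>auto simp: schur_col_part\<close>)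
  thus ?thesis by (intro fusion_ideal_bar_minimal J hsym_level)
qed

section \<open>The duality homomorphism\<close>

text \<open>The duality exchanges rows and columns, hence \<open>e\<close>s and \<open>h\<close>s.\<close>
definition dual_hom :: "nat \<Rightarrow> nat \<Rightarrow> qpoly \<Rightarrow> qpoly" where
  "dual_hom N k = sym_hom N (\<lambda>m. hsym k (int m))"

lemma dual_hom_sym: "f \<in> sym_polys N \<Longrightarrow> dual_hom N k f \<in> sym_polys k"
  unfolding dual_hom_def by (rule sym_hom_sym) (auto simp: hsym_sym)

lemmas dual_hom_simps =
  sym_hom_add[where r = "\<lambda>m. hsym k (int m)" for k, folded dual_hom_def]
  sym_hom_mult[where r = "\<lambda>m. hsym k (int m)" for k, folded dual_hom_def]
  sym_hom_uminus[where r = "\<lambda>m. hsym k (int m)" for k, folded dual_hom_def]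
  sym_hom_diff[where r = "\<lambda>m. hsym k (int m)" for k, folded dual_hom_def]
  sym_hom_sum[where r = "\<lambda>m. hsym k (int m)" for k, folded dual_hom_def]
  sym_hom_const[where r = "\<lambda>m. hsym k (int m)" for k, folded dual_hom_def]
  sym_hom_one[where r = "\<lambda>m. hsym k (int m)" for k, folded dual_hom_def]
  sym_hom_zero[where r = "\<lambda>m. hsym k (int m)" for k, folded dual_hom_def]
  sym_hom_esym[where r = "\<lambda>m. hsym k (int m)" for k, folded dual_hom_def]

lemma dual_hom_sgn: "dual_hom N k ((-1) ^ m) = (-1) ^ m"
  by (induction m) (simp_all add: dual_hom_simps sgn_sym)

text \<open>Here \<open>J\<close> satisfies the relations in \<open>k\<close> variables at level \<open>N\<close>; it receives the images of the
  relations in \<open>N\<close> variables at level \<open>k\<close>.\<close>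
locale dual_level = level_ideal k J N for N k :: nat and J +
  assumes N_pos: "N \<ge> 1"
begin

abbreviation dual_eqv (infix "\<approx>" 50) where "x \<approx> y \<equiv> sym_cong k J x y"

text \<open>In the range \<open>N < m < N + k\<close> both sides vanish: the left one because there are only \<open>N\<close>
  variables, the right one by the relations. The statement stops there: by periodicity
  \<open>hsym k (N + k)\<close> is congruent to \<open>(-1) ^ (k - 1)\<close>.\<close>
lemma dual_hom_esym:
  assumes "m < N + k"
  shows "dual_hom N k (esym N m) \<approx> hsym k (int m)"
proof -
  consider "m = 0" | "1 \<le> m" "m \<le> N" | "N < m" by linarith
  thus ?thesis
  proof cases
    case 1 thus ?thesis by (simp add: dual_hom_simps eqv_refl sym_one)
  next
    case 2 thus ?thesis by (simp add: dual_hom_simps eqv_refl hsym_sym)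
  next
    case 3
    hence "hsym k (int m) \<approx> 0" using hsym_vanish[of m] assms by (simp add: eqv_zero_iff)
    thus ?thesis using 3 eqv_sym by (simp add: esym_big dual_hom_simps)
  qed
qed

text \<open>Both sides are computed from the preceding congruence by the same recurrence.\<close>
lemma dual_hom_hsym:
  assumes "m < N + k"
  shows "dual_hom N k (hsym N (int m)) \<approx> esym k m"
  using assms
proof (induction m rule: less_induct)
  case (less m)
  show ?case
  proof (cases "m = 0")
    case True
    thus ?thesis by (simp add: dual_hom_simps eqv_refl sym_one)
  next
    case False
    hence "m > 0" by simp
    have expand: "dual_hom N k (hsym N (int m)) =
      (\<Sum>i\<in>{1..m}. (-1) ^ (i + 1) * dual_hom N k (esym N i) * dual_hom N k (hsym N (int (m - i))))"
      unfolding hsym_recurrence[OF \<open>m > 0\<close>, of N]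
      by (simp add: dual_hom_simps dual_hom_sgn sym_mult sgn_sym esym_sym hsym_sym sym_uminus)
    show ?thesis
      unfolding expand
      by (subst esym_recurrence[OF \<open>m > 0\<close>])
         (intro eqv_sum eqv_mult eqv_refl sgn_sym dual_hom_esym less.IH; use less.prems in auto)
  qed
qed

lemma dual_hom_hsym_int:
  assumes "m < int (N + k)"
  shows "dual_hom N k (hsym N m) \<approx> esym_int k m"
  using dual_hom_hsym[of "nat m"] assms
  by (cases "m < 0") (auto simp: hsym_neg esym_int_def dual_hom_simps eqv_refl sym_zero)

text \<open>Under \<open>dual_hom\<close> the relations \<open>e\<^sub>N = 1\<close> and \<open>h\<^sub>k = 1\<close> become \<open>h\<^sub>N = 1\<close> and \<open>e\<^sub>k = 1\<close>, and the
  vanishing of \<open>hsym N m\<close> for \<open>k < m < k + N\<close> becomes that of \<open>esym k m\<close>.\<close>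
lemma level_ideal_preimage: "level_ideal N {p \<in> sym_polys N. dual_hom N k p \<in> J} k"
proof (unfold_locales)
  show "sym_ideal N {p \<in> sym_polys N. dual_hom N k p \<in> J}"
    by (auto simp: sym_ideal_def sym_zero sym_add sym_mult dual_hom_simps J_zero intro: J_add J_mult dual_hom_sym)
  show "N \<ge> 1" by (rule N_pos)
  have "dual_hom N k (esym N N) - 1 \<in> J"
    using N_pos hsym_level by (simp add: dual_hom_simps)
  thus "esym N N - 1 \<in> {p \<in> sym_polys N. dual_hom N k p \<in> J}"
    by (simp add: dual_hom_simps sym_diff sym_one esym_sym)
  have "dual_hom N k (hsym N (int k)) \<approx> esym k k" using N_pos by (intro dual_hom_hsym) simp
  also have "esym k k \<approx> 1" using esym_top by (simp add: sym_cong_def esym_sym sym_one)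
  finally show "hsym N (int k) - 1 \<in> {p \<in> sym_polys N. dual_hom N k p \<in> J}"
    by (simp add: sym_cong_def dual_hom_simps sym_diff sym_one hsym_sym)
  fix m assume "k < m" "m < k + N"
  hence "dual_hom N k (hsym N (int m)) \<approx> 0"
    using dual_hom_hsym[of m] by (simp add: esym_big)
  thus "hsym N (int m) \<in> {p \<in> sym_polys N. dual_hom N k p \<in> J}"
    by (simp add: eqv_zero_iff hsym_sym)
qed

text \<open>All indices in the Jacobi-Trudi matrix of a partition inside the rectangle are below \<open>N + k\<close>,
  so the matrix goes entry by entry to the dual Jacobi-Trudi matrix of the conjugate.\<close>
lemma dual_hom_schur:
  assumes "partition_le N \<mu>" "\<mu> 0 \<le> k"
  shows "dual_hom N k (schur N \<mu>) \<approx> schur k (conj_part \<mu>)"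
proof -
  have "schur N \<mu> \<in> sym_polys N \<and> dual_hom N k (schur N \<mu>) \<approx> schur k (conj_part \<mu>)"
    unfolding schur_conj_dual[OF assms] unfolding schur_def
  proof (rule det_closed_rel[of "\<lambda>x y. x \<in> sym_polys N \<and> dual_hom N k x \<approx> y"])
    fix i j assume "i < N" "j < N"
    have "\<mu> i \<le> \<mu> 0" using assms(1) by (simp add: partition_le_def antimono_def)
    hence "int (\<mu> i) - int i + int j < int (N + k)" using assms(2) \<open>j < N\<close> by linarith
    thus "hsym N (int (\<mu> i) - int i + int j) \<in> sym_polys N \<and>
      dual_hom N k (hsym N (int (\<mu> i) - int i + int j)) \<approx> esym_int k (int (\<mu> i) - int i + int j)"
      using dual_hom_hsym_int hsym_sym by blast
  qed (auto simp: dual_hom_simps sym_add sym_mult sym_uminus sym_one intro: eqv_add eqv_mult eqv_uminus eqv_refl)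
  thus ?thesis by blast
qed

end

text \<open>It is enough to look at the generators \<open>e\<^sub>1, ..., e\<^sub>N\<close>, which go to \<open>h\<^sub>1, ..., h\<^sub>N\<close> and back.\<close>
lemma dual_hom_inverse:
  assumes "level_ideal N J k" "k \<ge> 1" and f: "f \<in> sym_polys N"
  shows "sym_cong N J (dual_hom k N (dual_hom N k f)) f"
proof -
  interpret dual_level k N J
    using assms by (simp add: dual_level_def dual_level_axioms_def)
  show ?thesis using f
  proof (induction rule: sym_induct)
    case (esym m)
    thus ?case using dual_hom_hsym[of m] assms(2) by (simp add: dual_hom_simps)
  qed (auto simp: dual_hom_simps dual_hom_sym eqv_refl sym_const intro: eqv_add eqv_mult)
qed

section \<open>Quotients of algebras\<close>

text \<open>Commutative rings whose scalar multiplication is multiplication by the multiples of the unit.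
  These conditions suffice for \<open>quot_alg\<close> to be well behaved, and they are inherited by it, so that
  quotients can be iterated.\<close>
definition scalar_ring :: "(rat, 'a, 'm) module_scheme \<Rightarrow> bool" where
  "scalar_ring A \<longleftrightarrow> cring A \<and>
     (\<forall>c. \<forall>x\<in>carrier A. c \<odot>\<^bsub>A\<^esub> x \<in> carrier A \<and> c \<odot>\<^bsub>A\<^esub> x = (c \<odot>\<^bsub>A\<^esub> \<one>\<^bsub>A\<^esub>) \<otimes>\<^bsub>A\<^esub> x)"

lemma scalar_ring_Lam: "scalar_ring (Lam n)"
  unfolding scalar_ring_def by (simp add: cring_Lam sym_mult sym_const)

text \<open>Transports the ring axioms between records that differ in their further fields only, such as a
  quotient ring and the algebra built from it.\<close>
lemma cring_cong:
  fixes R :: "('a, 'b) ring_scheme" and S :: "('a, 'c) ring_scheme"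
  assumes "cring R" "carrier S = carrier R" "monoid.mult S = monoid.mult R" "monoid.one S = monoid.one R"
    "ring.zero S = ring.zero R" "ring.add S = ring.add R"
  shows "cring S"
proof -
  interpret R: cring R by fact
  show ?thesis
  proof (rule cringI)
    show "abelian_group S"
    proof (rule abelian_groupI)
      fix x assume "x \<in> carrier S"
      thus "\<exists>y\<in>carrier S. y \<oplus>\<^bsub>S\<^esub> x = \<zero>\<^bsub>S\<^esub>"
        by (intro bexI[of _ "\<ominus>\<^bsub>R\<^esub> x"]) (simp_all add: assms(2-) R.l_neg)
    qed (simp_all add: assms(2-) R.a_ac)
    show "comm_monoid S"
      by (rule comm_monoidI) (simp_all add: assms(2-) R.m_ac)
  qed (simp_all add: assms(2-) R.l_distr)
qed

lemma quot_alg_simps: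
  "carrier (quot_alg A J) = carrier (A Quot J)" "monoid.mult (quot_alg A J) = monoid.mult (A Quot J)"
  "monoid.one (quot_alg A J) = monoid.one (A Quot J)" "ring.zero (quot_alg A J) = ring.zero (A Quot J)"
  "ring.add (quot_alg A J) = ring.add (A Quot J)"
  "c \<odot>\<^bsub>quot_alg A J\<^esub> X = J <+>\<^bsub>A\<^esub> (\<lambda>x. c \<odot>\<^bsub>A\<^esub> x) ` X"
  by (simp_all add: quot_alg_def ring.defs module.defs FactRing_def)

locale scalar_quotient =
  fixes A :: "(rat, 'a, 'm) module_scheme" and J :: "'a set"
  assumes A: "scalar_ring A" and ideal: "ideal J A"
begin

sublocale A: cring A using A unfolding scalar_ring_def by blast
sublocale ideal J A by (rule ideal)

abbreviation proj :: "'a \<Rightarrow> 'a set" where "proj x \<equiv> J +>\<^bsub>A\<^esub> x"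

lemma smult_closed: "x \<in> carrier A \<Longrightarrow> c \<odot>\<^bsub>A\<^esub> x \<in> carrier A"
  and smult_one: "x \<in> carrier A \<Longrightarrow> c \<odot>\<^bsub>A\<^esub> x = (c \<odot>\<^bsub>A\<^esub> \<one>\<^bsub>A\<^esub>) \<otimes>\<^bsub>A\<^esub> x"
  using A unfolding scalar_ring_def by blast+

lemma proj_hom: "proj \<in> Ring.ring_hom A (quot_alg A J)"
  using rcos_ring_hom unfolding Ring.ring_hom_def quot_alg_simps .

lemma proj_image: "proj ` carrier A = carrier (quot_alg A J)"
proof -
  have "carrier (quot_alg A J) = a_rcosets\<^bsub>A\<^esub> J" unfolding quot_alg_simps FactRing_def by (simp only: partial_object.simps)
  thus ?thesis unfolding A_RCOSETS_def' by (simp only: UNION_singleton_eq_range)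
qed

lemma proj_eq_iff:
  "x \<in> carrier A \<Longrightarrow> y \<in> carrier A \<Longrightarrow> proj x = proj y \<longleftrightarrow> x \<ominus>\<^bsub>A\<^esub> y \<in> J"
  by (rule A.quotient_eq_iff_same_a_r_cos[OF ideal, symmetric])

lemma proj_smult:
  assumes x: "x \<in> carrier A"
  shows "c \<odot>\<^bsub>quot_alg A J\<^esub> proj x = proj (c \<odot>\<^bsub>A\<^esub> x)"
proof -
  let ?c = "c \<odot>\<^bsub>A\<^esub> \<one>\<^bsub>A\<^esub>"
  have c: "?c \<in> carrier A" by (rule smult_closed) simp
  have Jc: "j \<in> carrier A" if "j \<in> J" for j using that a_subset by blast
  have J0: "\<zero>\<^bsub>A\<^esub> \<in> J" by (rule additive_subgroup.zero_closed[OF is_additive_subgroup])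
  have dist: "c \<odot>\<^bsub>A\<^esub> (j \<oplus>\<^bsub>A\<^esub> x) = ?c \<otimes>\<^bsub>A\<^esub> j \<oplus>\<^bsub>A\<^esub> c \<odot>\<^bsub>A\<^esub> x" if "j \<in> J" for j
    using smult_one[of "j \<oplus>\<^bsub>A\<^esub> x" c] smult_one[OF x, of c] x c Jc[OF that] by (simp add: A.r_distr)
  show ?thesis
  proof (rule Set.set_eqI)
    fix z
    have "z \<in> c \<odot>\<^bsub>quot_alg A J\<^esub> proj x \<longleftrightarrow> (\<exists>h\<in>J. \<exists>j\<in>J. z = h \<oplus>\<^bsub>A\<^esub> (c \<odot>\<^bsub>A\<^esub> (j \<oplus>\<^bsub>A\<^esub> x)))"
      unfolding quot_alg_simps(6) set_add_def' a_r_coset_def' by blast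
    also have "\<dots> \<longleftrightarrow> (\<exists>h\<in>J. z = h \<oplus>\<^bsub>A\<^esub> (c \<odot>\<^bsub>A\<^esub> x))"
    proof
      assume "\<exists>h\<in>J. \<exists>j\<in>J. z = h \<oplus>\<^bsub>A\<^esub> (c \<odot>\<^bsub>A\<^esub> (j \<oplus>\<^bsub>A\<^esub> x))"
      then obtain h j where hj: "h \<in> J" "j \<in> J" "z = h \<oplus>\<^bsub>A\<^esub> (c \<odot>\<^bsub>A\<^esub> (j \<oplus>\<^bsub>A\<^esub> x))" by blast
      have "z = (h \<oplus>\<^bsub>A\<^esub> ?c \<otimes>\<^bsub>A\<^esub> j) \<oplus>\<^bsub>A\<^esub> c \<odot>\<^bsub>A\<^esub> x"
        using hj dist[OF hj(2)] Jc c smult_closed[OF x] by (simp add: A.a_assoc)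
      moreover have "h \<oplus>\<^bsub>A\<^esub> ?c \<otimes>\<^bsub>A\<^esub> j \<in> J"
        using additive_subgroup.a_closed[OF is_additive_subgroup hj(1) I_l_closed[OF hj(2) c]] .
      ultimately show "\<exists>h\<in>J. z = h \<oplus>\<^bsub>A\<^esub> (c \<odot>\<^bsub>A\<^esub> x)" by blast
    next
      assume "\<exists>h\<in>J. z = h \<oplus>\<^bsub>A\<^esub> (c \<odot>\<^bsub>A\<^esub> x)"
      then obtain h where "h \<in> J" "z = h \<oplus>\<^bsub>A\<^esub> (c \<odot>\<^bsub>A\<^esub> (\<zero>\<^bsub>A\<^esub> \<oplus>\<^bsub>A\<^esub> x))"
        unfolding A.l_zero[OF x] by blast
      thus "\<exists>h\<in>J. \<exists>j\<in>J. z = h \<oplus>\<^bsub>A\<^esub> (c \<odot>\<^bsub>A\<^esub> (j \<oplus>\<^bsub>A\<^esub> x))" using J0 by blast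
    qed
    also have "\<dots> \<longleftrightarrow> z \<in> proj (c \<odot>\<^bsub>A\<^esub> x)" unfolding a_r_coset_def' by blast
    finally show "z \<in> c \<odot>\<^bsub>quot_alg A J\<^esub> proj x \<longleftrightarrow> z \<in> proj (c \<odot>\<^bsub>A\<^esub> x)" .
  qed
qed

lemma scalar_ring_quot: "scalar_ring (quot_alg A J)"
  unfolding scalar_ring_def
proof (intro conjI allI ballI)
  show "cring (quot_alg A J)"
    by (rule cring_cong[OF quotient_is_cring[OF A.is_cring]]) (simp_all add: quot_alg_simps)
  fix c X assume "X \<in> carrier (quot_alg A J)"
  then obtain x where x: "x \<in> carrier A" "X = proj x" using proj_image by blast
  show "c \<odot>\<^bsub>quot_alg A J\<^esub> X \<in> carrier (quot_alg A J)"
    unfolding x(2) proj_smult[OF x(1)] using ring_hom_closed[OF proj_hom smult_closed[OF x(1)]] .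
  have "\<one>\<^bsub>quot_alg A J\<^esub> = proj \<one>\<^bsub>A\<^esub>" using ring_hom_one[OF proj_hom] by simp
  hence "(c \<odot>\<^bsub>quot_alg A J\<^esub> \<one>\<^bsub>quot_alg A J\<^esub>) \<otimes>\<^bsub>quot_alg A J\<^esub> X
      = proj (c \<odot>\<^bsub>A\<^esub> \<one>\<^bsub>A\<^esub>) \<otimes>\<^bsub>quot_alg A J\<^esub> proj x"
    by (simp add: proj_smult x(2))
  also have "\<dots> = proj ((c \<odot>\<^bsub>A\<^esub> \<one>\<^bsub>A\<^esub>) \<otimes>\<^bsub>A\<^esub> x)"
    using ring_hom_mult[OF proj_hom smult_closed[OF A.one_closed] x(1)] by simp
  also have "\<dots> = c \<odot>\<^bsub>quot_alg A J\<^esub> X"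
    unfolding x(2) proj_smult[OF x(1)] using smult_one[OF x(1)] by simp
  finally show "c \<odot>\<^bsub>quot_alg A J\<^esub> X = (c \<odot>\<^bsub>quot_alg A J\<^esub> \<one>\<^bsub>quot_alg A J\<^esub>) \<otimes>\<^bsub>quot_alg A J\<^esub> X" by simp
qed

lemma proj_hom_cring: "ring_hom_cring A (quot_alg A J) proj"
  using scalar_ring_quot proj_hom A.is_cring
  unfolding scalar_ring_def ring_hom_cring_def ring_hom_cring_axioms_def by blast

end

text \<open>\<open>B\<close> is an algebra quotient of \<open>Lam n\<close> with kernel \<open>J\<close>. Both forms of the fusion quotient, the one
  by a single ideal and the iterated one, are instances, so that the duality has to be carried over
  only once.\<close>
definition presents :: "nat \<Rightarrow> qpoly set \<Rightarrow> (rat, 'b, 'm) module_scheme \<Rightarrow> (qpoly \<Rightarrow> 'b) \<Rightarrow> bool" where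
  "presents n J B \<pi> \<longleftrightarrow> \<pi> \<in> Ring.ring_hom (Lam n) B \<and> \<pi> ` sym_polys n = carrier B \<and>
     (\<forall>c. \<forall>x\<in>sym_polys n. \<pi> (const c * x) = c \<odot>\<^bsub>B\<^esub> \<pi> x) \<and>
     (\<forall>x\<in>sym_polys n. \<forall>y\<in>sym_polys n. \<pi> x = \<pi> y \<longleftrightarrow> x - y \<in> J)"

lemma presentsD:
  assumes "presents n J B \<pi>"
  shows "x \<in> sym_polys n \<Longrightarrow> \<pi> x \<in> carrier B"
    "x \<in> sym_polys n \<Longrightarrow> y \<in> sym_polys n \<Longrightarrow> \<pi> (x + y) = \<pi> x \<oplus>\<^bsub>B\<^esub> \<pi> y"
    "x \<in> sym_polys n \<Longrightarrow> y \<in> sym_polys n \<Longrightarrow> \<pi> (x * y) = \<pi> x \<otimes>\<^bsub>B\<^esub> \<pi> y"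
    "\<pi> 1 = \<one>\<^bsub>B\<^esub>"
    "x \<in> sym_polys n \<Longrightarrow> \<pi> (const c * x) = c \<odot>\<^bsub>B\<^esub> \<pi> x"
    "x \<in> sym_polys n \<Longrightarrow> y \<in> sym_polys n \<Longrightarrow> \<pi> x = \<pi> y \<longleftrightarrow> x - y \<in> J"
  using assms by (auto simp: presents_def Ring.ring_hom_def)

lemma presents_surj:
  assumes "presents n J B \<pi>" "X \<in> carrier B"
  shows "\<exists>x\<in>sym_polys n. \<pi> x = X"
proof -
  have "X \<in> \<pi> ` sym_polys n" using assms by (simp add: presents_def)
  thus ?thesis by blast
qed

lemma presents_quot:
  assumes "sym_ideal n J"
  shows "presents n J (quot_alg (Lam n) J) (\<lambda>x. J +>\<^bsub>Lam n\<^esub> x)"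
proof -
  interpret scalar_quotient "Lam n" J
    by (rule scalar_quotient.intro[OF scalar_ring_Lam]) (simp add: ideal_Lam_iff assms)
  show ?thesis
    using proj_hom proj_image proj_smult proj_eq_iff
    by (auto simp: presents_def Lam_a_minus)
qed

lemma presents_fusion_quot:
  "presents n (fusion_ideal_bar n l) (fusion_quot n l) (\<lambda>x. fusion_ideal_bar n l +>\<^bsub>Lam n\<^esub> x)"
  unfolding fusion_quot_def by (rule presents_quot[OF sym_ideal_fusion_ideal_bar])

text \<open>The third isomorphism theorem: the kernel of the composite projection is the ideal generated
  by the fusion ideal and \<open>h\<^sub>l - 1\<close>. The image of that ideal is an ideal of the fusion algebra, and the
  preimage of the principal ideal is an ideal of \<open>Lam n\<close>; minimality gives the two inclusions.\<close>
lemma presents_fusion_alg':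
  "\<exists>\<pi>. presents n (fusion_ideal_bar n l) (fusion_alg' n l) \<pi>"
proof -
  define I where "I = fusion_ideal n l"
  define F where "F = fusion_alg n l"
  define K where "K = Idl\<^bsub>F\<^esub> {fusion_top n l \<ominus>\<^bsub>F\<^esub> \<one>\<^bsub>F\<^esub>}"
  define p where "p x = I +>\<^bsub>Lam n\<^esub> x" for x
  define q where "q X = K +>\<^bsub>F\<^esub> X" for X
  have F_quot: "F = quot_alg (Lam n) I" by (simp add: F_def fusion_alg_def I_def)
  interpret Q: scalar_quotient "Lam n" I
    by (rule scalar_quotient.intro[OF scalar_ring_Lam]) (simp add: ideal_Lam_iff I_def sym_ideal_fusion_ideal)
  interpret p: ring_hom_cring "Lam n" F p
  proof -
    have "p = Q.proj" by (simp add: p_def fun_eq_iff)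
    thus "ring_hom_cring (Lam n) F p" using Q.proj_hom_cring by (simp only: F_quot)
  qed
  have p: "presents n I F p"
    unfolding F_quot p_def by (rule presents_quot) (simp add: I_def sym_ideal_fusion_ideal)
  have scalar_F: "scalar_ring F" unfolding F_quot by (rule Q.scalar_ring_quot)
  have p_closed: "p x \<in> carrier F" if "x \<in> sym_polys n" for x using presentsD(1)[OF p that] .
  have p_minus: "p x \<ominus>\<^bsub>F\<^esub> p y = p (x - y)" if "x \<in> sym_polys n" "y \<in> sym_polys n" for x y
  proof -
    have "p x \<ominus>\<^bsub>F\<^esub> p y = p x \<oplus>\<^bsub>F\<^esub> p (- y)"
      using p.hom_a_inv[of y] that by (simp add: a_minus_def Lam_a_inv)
    thus ?thesis using presentsD(2)[OF p that(1) sym_uminus[OF that(2)]] by simp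
  qed
  have p_zero: "p 0 = \<zero>\<^bsub>F\<^esub>" using p.hom_zero by simp
  have gen: "fusion_top n l \<ominus>\<^bsub>F\<^esub> \<one>\<^bsub>F\<^esub> = p (hsym n (int l) - 1)"
  proof -
    have "fusion_top n l = p (hsym n (int l))" by (simp add: fusion_top_def p_def I_def)
    moreover have "\<one>\<^bsub>F\<^esub> = p 1" using presentsD(4)[OF p] by simp
    ultimately show ?thesis using p_minus[OF hsym_sym sym_one] by simp
  qed
  have K_ideal: "ideal K F"
    unfolding K_def gen by (rule p.S.genideal_ideal) (simp add: p_closed sym_diff sym_one hsym_sym)
  interpret K: ideal K F by (rule K_ideal)
  interpret R: scalar_quotient F K by (rule scalar_quotient.intro[OF scalar_F K_ideal])
  let ?J = "fusion_ideal_bar n l"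
  interpret J: sym_ideal_loc n ?J by unfold_locales (rule sym_ideal_fusion_ideal_bar)
  have K_iff: "p z \<in> K \<longleftrightarrow> z \<in> ?J" if z: "z \<in> sym_polys n" for z
  proof
    assume "p z \<in> K"
    have "ideal (p ` ?J) F"
    proof (rule idealI[OF p.S.ring_axioms])
      show "subgroup (p ` ?J) (add_monoid F)"
      proof (rule subgroup.intro)
        fix X assume "X \<in> p ` ?J"
        then obtain x where x: "x \<in> ?J" "X = p x" by blast
        have "\<ominus>\<^bsub>F\<^esub> X = p (- x)" using p.hom_a_inv[of x] J.J_sub[OF x(1)] x(2) by (simp add: Lam_a_inv)
        thus "inv\<^bsub>add_monoid F\<^esub> X \<in> p ` ?J" using J.J_uminus[OF x(1)] by (simp add: a_inv_def)
      next
        fix X Y assume "X \<in> p ` ?J" "Y \<in> p ` ?J"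
        then obtain x y where "x \<in> ?J" "X = p x" "y \<in> ?J" "Y = p y" by blast
        thus "X \<otimes>\<^bsub>add_monoid F\<^esub> Y \<in> p ` ?J"
          using presentsD(2)[OF p J.J_sub J.J_sub, of x y] J.J_add[of x y] by (auto intro!: image_eqI[of _ _ "x + y"])
      qed (use p_closed J.J_sub J.J_zero p_zero in \<open>auto intro!: image_eqI[of _ _ 0]\<close>)
    next
      fix X Y assume "X \<in> p ` ?J" "Y \<in> carrier F"
      then obtain x y where xy: "x \<in> ?J" "X = p x" "y \<in> sym_polys n" "Y = p y"
        using presents_surj[OF p] by blast
      have "Y \<otimes>\<^bsub>F\<^esub> X = p (y * x)" using presentsD(3)[OF p xy(3) J.J_sub[OF xy(1)]] xy by simp
      moreover have "y * x \<in> ?J" using J.J_mult xy by blast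
      ultimately show YX: "Y \<otimes>\<^bsub>F\<^esub> X \<in> p ` ?J" by simp
      have "X \<in> carrier F" using xy p_closed J.J_sub by simp
      thus "X \<otimes>\<^bsub>F\<^esub> Y \<in> p ` ?J" using YX p.S.m_comm \<open>Y \<in> carrier F\<close> by simp
    qed
    hence "K \<subseteq> p ` ?J"
      unfolding K_def gen by (rule p.S.genideal_minimal) (simp add: fusion_ideal_bar_contains(2))
    then obtain w where w: "w \<in> ?J" "p z = p w" using \<open>p z \<in> K\<close> by blast
    hence "z - w \<in> I" using presentsD(6)[OF p z J.J_sub[OF w(1)]] by simp
    hence "(z - w) + w \<in> ?J" using w(1) by (intro J.J_add) (auto simp: I_def fusion_ideal_bar_contains)
    thus "z \<in> ?J" by simp
  next
    assume "z \<in> ?J"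
    have "?J \<subseteq> {z \<in> sym_polys n. p z \<in> K}"
    proof (rule fusion_ideal_bar_minimal)
      show "sym_ideal n {z \<in> sym_polys n. p z \<in> K}"
        unfolding sym_ideal_def
        using presentsD(2,3)[OF p] p_zero p_closed additive_subgroup.zero_closed[OF K.is_additive_subgroup]
          additive_subgroup.a_closed[OF K.is_additive_subgroup] K.I_l_closed
        by (auto simp: sym_add sym_mult sym_zero)
      show "fusion_ideal n l \<subseteq> {z \<in> sym_polys n. p z \<in> K}"
      proof
        fix x assume x: "x \<in> fusion_ideal n l"
        hence "x \<in> sym_polys n" using fusion_ideal_sub by blast
        moreover have "p x = p 0" using presentsD(6)[OF p calculation sym_zero] x by (simp add: I_def)
        ultimately show "x \<in> {z \<in> sym_polys n. p z \<in> K}"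
          using p_zero additive_subgroup.zero_closed[OF K.is_additive_subgroup] by simp
      qed
      have "p (hsym n (int l) - 1) \<in> K"
        using p.S.genideal_self[of "{fusion_top n l \<ominus>\<^bsub>F\<^esub> \<one>\<^bsub>F\<^esub>}"]
        unfolding K_def gen by (simp add: p_closed sym_diff sym_one hsym_sym)
      thus "hsym n (int l) - 1 \<in> {z \<in> sym_polys n. p z \<in> K}" by (simp add: sym_diff sym_one hsym_sym)
    qed
    thus "p z \<in> K" using \<open>z \<in> ?J\<close> by blast
  qed
  have "presents n ?J (quot_alg F K) (\<lambda>x. q (p x))"
    unfolding presents_def
  proof (intro conjI allI ballI)
    show "(\<lambda>x. q (p x)) \<in> Ring.ring_hom (Lam n) (quot_alg F K)"
      using ring_hom_trans[OF p.homh R.proj_hom] by (simp add: comp_def q_def)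
    show "(\<lambda>x. q (p x)) ` sym_polys n = carrier (quot_alg F K)"
    proof -
      have "p ` sym_polys n = carrier F" using p by (simp add: presents_def)
      hence "(\<lambda>x. q (p x)) ` sym_polys n = q ` carrier F" by (metis image_image)
      thus ?thesis using R.proj_image unfolding q_def by simp
    qed
    fix x assume x: "x \<in> sym_polys n"
    show "q (p (const c * x)) = c \<odot>\<^bsub>quot_alg F K\<^esub> q (p x)" for c
      using presentsD(5)[OF p x] R.proj_smult[OF p_closed[OF x]] by (simp add: q_def)
    fix y assume y: "y \<in> sym_polys n"
    show "q (p x) = q (p y) \<longleftrightarrow> x - y \<in> ?J"
      unfolding q_def R.proj_eq_iff[OF p_closed[OF x] p_closed[OF y]] p_minus[OF x y]
      by (rule K_iff[OF sym_diff[OF x y]])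
  qed
  thus ?thesis unfolding fusion_alg'_def F_def[symmetric] K_def by blast
qed

section \<open>Rank-level duality\<close>

lemma dual_hom_fusion_ideal_bar:
  assumes "N \<ge> 2" "k \<ge> 1" "x \<in> fusion_ideal_bar N k"
  shows "dual_hom N k x \<in> fusion_ideal_bar k N"
proof -
  interpret dual_level N k "fusion_ideal_bar k N"
    using assms level_ideal_fusion_ideal_bar[of k N] by (simp add: dual_level_def dual_level_axioms_def)
  show ?thesis using fusion_ideal_bar_le[OF level_ideal_preimage assms(1)] assms(3) by blast
qed

lemma induced_map:
  assumes "N \<ge> 2" "k \<ge> 1"
    and B: "presents N (fusion_ideal_bar N k) B \<pi>" and D: "presents k (fusion_ideal_bar k N) D \<rho>"
  shows "\<exists>f. \<forall>x\<in>sym_polys N. f (\<pi> x) = \<rho> (dual_hom N k x)"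
proof -
  define sec where "sec X = (SOME x. x \<in> sym_polys N \<and> \<pi> x = X)" for X
  have "\<rho> (dual_hom N k (sec (\<pi> x))) = \<rho> (dual_hom N k x)" if x: "x \<in> sym_polys N" for x
  proof -
    have "\<exists>y. y \<in> sym_polys N \<and> \<pi> y = \<pi> x" using x by blast
    hence s: "sec (\<pi> x) \<in> sym_polys N" "\<pi> (sec (\<pi> x)) = \<pi> x"
      unfolding sec_def by (rule someI2_ex, blast)+
    hence "sec (\<pi> x) - x \<in> fusion_ideal_bar N k" using presentsD(6)[OF B s(1) x] by simp
    hence "dual_hom N k (sec (\<pi> x) - x) \<in> fusion_ideal_bar k N"
      by (rule dual_hom_fusion_ideal_bar[OF assms(1,2)])
    thus ?thesis
      using presentsD(6)[OF D dual_hom_sym[OF s(1)] dual_hom_sym[OF x]] by (simp add: dual_hom_simps s(1) x)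
  qed
  thus ?thesis by (intro exI[of _ "\<lambda>X. \<rho> (dual_hom N k (sec X))"]) blast
qed

theorem rank_level_iso:
  assumes N: "N \<ge> 2" and k: "k \<ge> 2"
    and B: "presents N (fusion_ideal_bar N k) B \<pi>" and D: "presents k (fusion_ideal_bar k N) D \<rho>"
  shows "\<exists>f\<in>alg_iso B D. \<forall>x\<in>sym_polys N. f (\<pi> x) = \<rho> (dual_hom N k x)"
proof -
  have k1: "k \<ge> 1" and N1: "N \<ge> 1" using N k by auto
  obtain f where f: "\<And>x. x \<in> sym_polys N \<Longrightarrow> f (\<pi> x) = \<rho> (dual_hom N k x)"
    using induced_map[OF N k1 B D] by blast
  obtain g where g: "\<And>x. x \<in> sym_polys k \<Longrightarrow> g (\<rho> x) = \<pi> (dual_hom k N x)"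
    using induced_map[OF k N1 D B] by blast
  note B' = presentsD[OF B] and D' = presentsD[OF D]
  have gf: "g (f (\<pi> x)) = \<pi> x" if x: "x \<in> sym_polys N" for x
    using dual_hom_inverse[OF level_ideal_fusion_ideal_bar[OF N1] k1 x] B'(6)[OF dual_hom_sym[OF dual_hom_sym[OF x]] x]
    by (simp add: f[OF x] g[OF dual_hom_sym[OF x]] sym_cong_def)
  have fg: "f (g (\<rho> x)) = \<rho> x" if x: "x \<in> sym_polys k" for x
    using dual_hom_inverse[OF level_ideal_fusion_ideal_bar[OF k1] N1 x] D'(6)[OF dual_hom_sym[OF dual_hom_sym[OF x]] x]
    by (simp add: g[OF x] f[OF dual_hom_sym[OF x]] sym_cong_def)
  have f_closed: "f X \<in> carrier D" if "X \<in> carrier B" for X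
    using presents_surj[OF B that] f D'(1)[OF dual_hom_sym] by metis
  have f_add: "f (X \<oplus>\<^bsub>B\<^esub> Y) = f X \<oplus>\<^bsub>D\<^esub> f Y" if XY: "X \<in> carrier B" "Y \<in> carrier B" for X Y
  proof -
    obtain x y where xy: "x \<in> sym_polys N" "\<pi> x = X" "y \<in> sym_polys N" "\<pi> y = Y" using presents_surj[OF B] XY by metis
    have "f (\<pi> (x + y)) = \<rho> (dual_hom N k x + dual_hom N k y)"
      using xy by (simp add: f sym_add dual_hom_simps)
    also have "\<dots> = \<rho> (dual_hom N k x) \<oplus>\<^bsub>D\<^esub> \<rho> (dual_hom N k y)"
      using xy by (intro D'(2) dual_hom_sym)
    finally show ?thesis using B'(2)[OF xy(1,3)] xy(1,3) unfolding xy(2,4)[symmetric] by (simp add: f)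
  qed
  have f_mult: "f (X \<otimes>\<^bsub>B\<^esub> Y) = f X \<otimes>\<^bsub>D\<^esub> f Y" if XY: "X \<in> carrier B" "Y \<in> carrier B" for X Y
  proof -
    obtain x y where xy: "x \<in> sym_polys N" "\<pi> x = X" "y \<in> sym_polys N" "\<pi> y = Y" using presents_surj[OF B] XY by metis
    have "f (\<pi> (x * y)) = \<rho> (dual_hom N k x * dual_hom N k y)"
      using xy by (simp add: f sym_mult dual_hom_simps)
    also have "\<dots> = \<rho> (dual_hom N k x) \<otimes>\<^bsub>D\<^esub> \<rho> (dual_hom N k y)"
      using xy by (intro D'(3) dual_hom_sym)
    finally show ?thesis using B'(3)[OF xy(1,3)] xy(1,3) unfolding xy(2,4)[symmetric] by (simp add: f)
  qed
  have f_smult: "f (c \<odot>\<^bsub>B\<^esub> X) = c \<odot>\<^bsub>D\<^esub> f X" if X: "X \<in> carrier B" for c X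
  proof -
    obtain x where x: "x \<in> sym_polys N" "\<pi> x = X" using presents_surj[OF B] X by metis
    have "f (\<pi> (const c * x)) = \<rho> (const c * dual_hom N k x)"
      using x by (simp add: f sym_mult sym_const dual_hom_simps)
    also have "\<dots> = c \<odot>\<^bsub>D\<^esub> \<rho> (dual_hom N k x)" using x by (intro D'(5) dual_hom_sym)
    finally show ?thesis using B'(5)[OF x(1)] x(1) unfolding x(2)[symmetric] by (simp add: f)
  qed
  have f_one: "f \<one>\<^bsub>B\<^esub> = \<one>\<^bsub>D\<^esub>"
    using f[OF sym_one] B'(4) D'(4) by (simp add: dual_hom_simps)
  have g_closed: "g X \<in> carrier B" if "X \<in> carrier D" for X
    using presents_surj[OF D that] g B'(1)[OF dual_hom_sym] by metis
  have "bij_betw f (carrier B) (carrier D)"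
  proof (rule bij_betw_byWitness[where f' = g])
    show "\<forall>X\<in>carrier B. g (f X) = X" using presents_surj[OF B] gf by metis
    show "\<forall>X\<in>carrier D. f (g X) = X" using presents_surj[OF D] fg by metis
  qed (use f_closed g_closed in auto)
  moreover have "f \<in> Ring.ring_hom B D"
    using f_closed f_add f_mult f_one by (intro ring_hom_memI) auto
  ultimately have "f \<in> alg_iso B D"
    using f_closed f_add f_smult by (auto simp: alg_iso_def ring_iso_def linear_map_on_def)
  thus ?thesis using f by blast
qed

text \<open>By straightening, the Schur polynomials of the partitions inside the rectangle span the
  quotient.\<close>
lemma linear_map_on_box_schur_unique:
  assumes N: "N \<ge> 1" and B: "presents N (fusion_ideal_bar N k) B \<pi>" and D: "presents k J D \<rho>"
    and g: "linear_map_on B D g" and h: "linear_map_on B D h"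
    and eq: "\<And>\<mu>. partition_le N \<mu> \<Longrightarrow> \<mu> 0 \<le> k \<Longrightarrow> g (\<pi> (schur N \<mu>)) = h (\<pi> (schur N \<mu>))"
    and X: "X \<in> carrier B"
  shows "g X = h X"
proof -
  interpret level_ideal N "fusion_ideal_bar N k" k by (rule level_ideal_fusion_ideal_bar[OF N])
  note B' = presentsD[OF B] and D' = presentsD[OF D]
  have closed: "u (\<pi> x) \<in> carrier D" if "linear_map_on B D u" "x \<in> sym_polys N" for u x
    using that B'(1) by (auto simp: linear_map_on_def)
  have add: "u (\<pi> (x + y)) = u (\<pi> x) \<oplus>\<^bsub>D\<^esub> u (\<pi> y)"
    if "linear_map_on B D u" "x \<in> sym_polys N" "y \<in> sym_polys N" for u x y
    using that B'(1,2) by (simp add: linear_map_on_def)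
  have smult: "u (\<pi> (const c * x)) = c \<odot>\<^bsub>D\<^esub> u (\<pi> x)"
    if "linear_map_on B D u" "x \<in> sym_polys N" for u c x
    using that B'(1,5) by (simp add: linear_map_on_def)
  have zero: "u (\<pi> x) = \<rho> 0" if u: "linear_map_on B D u" and x: "x \<in> fusion_ideal_bar N k" for u x
  proof -
    \<comment> \<open>A linear map kills zero because it commutes with the scalar zero.\<close>
    obtain y where y: "y \<in> sym_polys k" "\<rho> y = u (\<pi> x)" using presents_surj[OF D] closed[OF u J_sub[OF x]] by blast
    have "\<pi> x = \<pi> 0" using B'(6)[OF J_sub[OF x] sym_zero] x by simp
    also have "\<dots> = \<pi> (const 0 * x)" by simp
    finally have "u (\<pi> x) = 0 \<odot>\<^bsub>D\<^esub> u (\<pi> x)" using smult[OF u J_sub[OF x], of 0] by simp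
    also have "\<dots> = \<rho> (const 0 * y)" using D'(5)[OF y(1), of 0] y(2) by simp
    finally show ?thesis by simp
  qed
  obtain x where x: "x \<in> sym_polys N" "\<pi> x = X" using presents_surj[OF B X] by blast
  from x(1) have "g (\<pi> x) = h (\<pi> x)"
  proof (rule box_schur_span)
    show "g (\<pi> y) = h (\<pi> y)" if "y \<in> fusion_ideal_bar N k" for y
      using zero[OF g that] zero[OF h that] by simp
    show "g (\<pi> (y + z)) = h (\<pi> (y + z))"
      if "y \<in> sym_polys N" "z \<in> sym_polys N" "g (\<pi> y) = h (\<pi> y)" "g (\<pi> z) = h (\<pi> z)" for y z
      using add[OF g that(1,2)] add[OF h that(1,2)] that(3,4) by simp
    show "g (\<pi> (const c * y)) = h (\<pi> (const c * y))"
      if "y \<in> sym_polys N" "g (\<pi> y) = h (\<pi> y)" for c y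
      using smult[OF g that(1)] smult[OF h that(1)] that(2) by simp
  qed (rule eq)
  thus ?thesis using x(2) by simp
qed

theorem mainTheorem4:
  fixes N k :: nat
  assumes "N \<ge> 2" and "k \<ge> 2"
  shows "(\<exists>f \<in> alg_iso (fusion_quot N k) (fusion_quot k N).
            transposes N k f \<and>
            (\<forall>g. linear_map_on (fusion_quot N k) (fusion_quot k N) g \<and> transposes N k g \<longrightarrow>
                 (\<forall>x \<in> carrier (fusion_quot N k). g x = f x)))
       \<and> alg_iso (fusion_alg' N k) (fusion_alg' k N) \<noteq> {}"
proof
  note P = presents_fusion_quot[of N k] and P' = presents_fusion_quot[of k N]
  obtain f where f: "f \<in> alg_iso (fusion_quot N k) (fusion_quot k N)"
    and f_proj: "\<And>x. x \<in> sym_polys N \<Longrightarrow> f (fusion_ideal_bar N k +>\<^bsub>Lam N\<^esub> x)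
        = fusion_ideal_bar k N +>\<^bsub>Lam k\<^esub> dual_hom N k x"
    using rank_level_iso[OF assms P P'] by blast
  interpret dual_level N k "fusion_ideal_bar k N"
    using assms level_ideal_fusion_ideal_bar[of k N] by (simp add: dual_level_def dual_level_axioms_def)
  have "transposes N k f"
    unfolding transposes_def
  proof (intro allI impI)
    fix \<mu> assume "partition_le N \<mu> \<and> \<mu> 0 \<le> k"
    hence "sym_cong k (fusion_ideal_bar k N) (dual_hom N k (schur N \<mu>)) (schur k (conj_part \<mu>))"
      by (intro dual_hom_schur) auto
    hence "fusion_ideal_bar k N +>\<^bsub>Lam k\<^esub> dual_hom N k (schur N \<mu>) = fusion_ideal_bar k N +>\<^bsub>Lam k\<^esub> schur k (conj_part \<mu>)"
      using presentsD(6)[OF P'] by (simp add: sym_cong_def)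
    thus "f (schur_class N k \<mu>) = schur_class k N (conj_part \<mu>)"
      by (simp add: schur_class_def f_proj schur_sym)
  qed
  moreover have "g X = f X" if g: "linear_map_on (fusion_quot N k) (fusion_quot k N) g" "transposes N k g"
    and X: "X \<in> carrier (fusion_quot N k)" for g X
  proof (rule linear_map_on_box_schur_unique[OF _ P P' g(1) _ _ X])
    show "linear_map_on (fusion_quot N k) (fusion_quot k N) f" using f by (simp add: alg_iso_def)
    fix \<mu> assume "partition_le N \<mu>" "\<mu> 0 \<le> k"
    thus "g (fusion_ideal_bar N k +>\<^bsub>Lam N\<^esub> schur N \<mu>) = f (fusion_ideal_bar N k +>\<^bsub>Lam N\<^esub> schur N \<mu>)"
      using g(2) \<open>transposes N k f\<close> by (simp add: transposes_def schur_class_def)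
  qed (use assms in simp)
  ultimately show "\<exists>f \<in> alg_iso (fusion_quot N k) (fusion_quot k N).
            transposes N k f \<and>
            (\<forall>g. linear_map_on (fusion_quot N k) (fusion_quot k N) g \<and> transposes N k g \<longrightarrow>
                 (\<forall>x \<in> carrier (fusion_quot N k). g x = f x))"
    using f by blast
next
  obtain \<pi> \<rho> where "presents N (fusion_ideal_bar N k) (fusion_alg' N k) \<pi>"
    "presents k (fusion_ideal_bar k N) (fusion_alg' k N) \<rho>"
    using presents_fusion_alg' by blast
  from rank_level_iso[OF assms this] show "alg_iso (fusion_alg' N k) (fusion_alg' k N) \<noteq> {}" by blast
qed

end
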